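(* Let $q>3$ be a prime power and let $\mathcal{X}$ be the Cartan scheme of the group $\mathrm{PSL}(2,q)$. Then $\mathcal{X}$ is $2$-separable and $b(\mathcal{X})=2$.
   Context: **Cartan scheme.** The Cartan subgroup $H$ of $G=\mathrm{PSL}(2,q)$ is the image in $G$ of the subgroup of diagonal matrices of $\mathrm{SL}(2,q)$. The Cartan scheme of $G$ is $\mathrm{Inv}(G,\Omega)$, where $\Omega=G/H$ is the set of right cosets of $H$ in $G$, on which $G$ acts by right multiplication, and $\mathrm{Inv}(G,\Omega)=(\Omega,S)$ with $S$ the set of orbits of $G$ on $\Omega\times\Omega$. **Coherent configurations.** Let $\Omega$ be a finite set. For $r\subseteq\Omega\times\Omega$ and $\alpha\in\Omega$ put $r^*=\{(\beta,\alpha):(\alpha,\beta)\in r\}$ and $\alpha r=\{\beta:(\alpha,\beta)\in r\}$; $1_\Omega$ is the diagonal of $\Omega\times\Omega$. A coherent configuration on $\Omega$ is a pair $\mathcal{X}=(\Omega,S)$, where $S$ is a partition of $\Omega\times\Omega$ such that $1_\Omega$ is a union of elements of $S$, $s^*\in S$ for all $s\in S$, and for all $r,s,t\in S$ the intersection number $c_{rs}^t=|\alpha r\cap\beta s^*|$ does not depend on $(\alpha,\beta)\in t$. The elements of $S$ are the basis relations, unions of them are the relations; a fiber is a set $\Gamma\subseteq\Omega$ with $1_\Gamma=\{(\gamma,\gamma):\gamma\in\Gamma\}\in S$. For coherent configurations on the same set, $\mathcal{X}\le\mathcal{X}'$ means that every relation of $\mathcal{X}$ is a relation of $\mathcal{X}'$;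 "smallest" refers to this order. **Base number.** $\mathcal{X}$ is complete if all its basis relations are singletons. The point extension $\mathcal{X}_{\alpha,\beta,\ldots}$ is the smallest coherent configuration on $\Omega$ that is $\ge\mathcal{X}$ and has $\{(\alpha,\alpha)\},\{(\beta,\beta)\},\ldots$ as relations. A set $\{\alpha,\beta,\ldots\}\subseteq\Omega$ is a base of $\mathcal{X}$ if $\mathcal{X}_{\alpha,\beta,\ldots}$ is complete; $b(\mathcal{X})$ is the smallest cardinality of a base. **Separability.** An algebraic isomorphism from $\mathcal{X}=(\Omega,S)$ to $\mathcal{X}'=(\Omega',S')$ is a bijection $\varphi:S\to S'$, $r\mapsto r'$, with $c_{rs}^t=c_{r's'}^{t'}$ for all $r,s,t\in S$; it extends naturally to relations. It is induced by an isomorphism if there is a bijection $f:\Omega\to\Omega'$ with $\{(\alpha^f,\beta^f):(\alpha,\beta)\in s\}=\varphi(s)$ for all $s\in S$. The $m$-extension of $\mathcal{X}$ is the smallest coherent configuration on $\Omega^m$ that contains the Cartesian $m$-power $\mathcal{X}^m$ of $\mathcal{X}$ and for which $\mathrm{Diag}(\Omega^m)=\{(\alpha,\ldots,\alpha):\alpha\in\Omega\}$ is a union of fibers. An algebraic isomorphism $\varphi:\mathcal{X}\to\mathcal{X}'$ is $m$-dimensional if there is an algebraic isomorphism from the $m$-extension of $\mathcal{X}$ to the $m$-extension of $\mathcal{X}'$ that takes $1_{\mathrm{Diag}(\Omega^m)}$ to $1_{\mathrm{Diag}(\Omega'^m)}$ and takes each relation $s_1\times\cdots\times s_m$ of $\mathcal{X}^m$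 ($s_i\in S$) to $\varphi(s_1)\times\cdots\times\varphi(s_m)$. $\mathcal{X}$ is $m$-separable if every $m$-dimensional algebraic isomorphism from $\mathcal{X}$ to another coherent configuration is induced by an isomorphism. *)

theory Defs
  imports
    "HOL-Algebra.Coset"
    "HOL-Algebra.Group_Action"
    "HOL-Analysis.Determinants"
    "HOL-Library.Disjoint_Sets"
    "HOL-Number_Theory.Prime_Powers"
begin

section \<open>Coherent configurations\<close>

type_synonym 'a config = "'a set \<times> 'a rel set"

abbreviation points :: "'a config \<Rightarrow> 'a set" where
  "points X \<equiv> fst X"

abbreviation basis :: "'a config \<Rightarrow> 'a rel set" where
  "basis X \<equiv> snd X"

definition relations :: "'a config \<Rightarrow> 'a rel set" where
  "relations X = {\<Union>T | T. T \<subseteq> basis X}"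

definition coherent_config :: "'a config \<Rightarrow> bool" where
  "coherent_config X \<longleftrightarrow>
     finite (points X) \<and>
     partition_on (points X \<times> points X) (basis X) \<and>
     Id_on (points X) \<in> relations X \<and>
     (\<forall>s \<in> basis X. s\<inverse> \<in> basis X) \<and>
     (\<forall>r \<in> basis X. \<forall>s \<in> basis X. \<forall>t \<in> basis X. \<exists>n. \<forall>(\<alpha>, \<beta>) \<in> t.
        card (r `` {\<alpha>} \<inter> s\<inverse> `` {\<beta>}) = n)"

text \<open>Well defined when \<open>r\<close>, \<open>s\<close>, \<open>t\<close> are basis relations of one coherent
  configuration: a basis relation is nonempty.\<close>

definition intersection_number :: "'a rel \<Rightarrow> 'a rel \<Rightarrow> 'a rel \<Rightarrow> nat" where
  "intersection_number r s t =
     (THE n. \<forall>(\<alpha>, \<beta>) \<in> t. card (r `` {\<alpha>} \<inter> s\<inverse> `` {\<beta>}) = n)"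

definition fibers :: "'a config \<Rightarrow> 'a set set" where
  "fibers X = {\<Gamma>. \<Gamma> \<subseteq> points X \<and> Id_on \<Gamma> \<in> basis X}"

definition config_le :: "'a config \<Rightarrow> 'a config \<Rightarrow> bool" (infix \<open>\<sqsubseteq>\<^sub>c\<close> 50) where
  "X \<sqsubseteq>\<^sub>c Y \<longleftrightarrow> points X = points Y \<and> relations X \<subseteq> relations Y"

definition smallest_config :: "('a config \<Rightarrow> bool) \<Rightarrow> 'a config" where
  "smallest_config P =
     (THE X. coherent_config X \<and> P X \<and> (\<forall>Y. coherent_config Y \<and> P Y \<longrightarrow> X \<sqsubseteq>\<^sub>c Y))"


section \<open>Base number\<close>

definition complete_config :: "'a config \<Rightarrow> bool" where
  "complete_config X \<longleftrightarrow> (\<forall>s \<in> basis X. is_singleton s)"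

definition point_extension :: "'a config \<Rightarrow> 'a set \<Rightarrow> 'a config" where
  "point_extension X A =
     smallest_config (\<lambda>Y. X \<sqsubseteq>\<^sub>c Y \<and> (\<forall>\<alpha> \<in> A. {(\<alpha>, \<alpha>)} \<in> relations Y))"

definition is_base :: "'a config \<Rightarrow> 'a set \<Rightarrow> bool" where
  "is_base X A \<longleftrightarrow> A \<subseteq> points X \<and> complete_config (point_extension X A)"

definition base_number :: "'a config \<Rightarrow> nat" where
  "base_number X = (LEAST n. \<exists>A. is_base X A \<and> card A = n)"


section \<open>Separability\<close>

definition algebraic_iso :: "'a config \<Rightarrow> 'b config \<Rightarrow> ('a rel \<Rightarrow> 'b rel) \<Rightarrow> bool" where
  "algebraic_iso X X' \<phi> \<longleftrightarrow>
     bij_betw \<phi> (basis X) (basis X') \<and>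
     (\<forall>r \<in> basis X. \<forall>s \<in> basis X. \<forall>t \<in> basis X.
        intersection_number r s t = intersection_number (\<phi> r) (\<phi> s) (\<phi> t))"

text \<open>The natural extension of a map on basis relations to all relations.\<close>

definition rel_ext :: "'a config \<Rightarrow> ('a rel \<Rightarrow> 'b rel) \<Rightarrow> 'a rel \<Rightarrow> 'b rel" where
  "rel_ext X \<phi> r = \<Union>(\<phi> ` {s \<in> basis X. s \<subseteq> r})"

definition induced_by_iso :: "'a config \<Rightarrow> 'b config \<Rightarrow> ('a rel \<Rightarrow> 'b rel) \<Rightarrow> bool" where
  "induced_by_iso X X' \<phi> \<longleftrightarrow>
     (\<exists>f. bij_betw f (points X) (points X') \<and>
          (\<forall>s \<in> basis X. {(f \<alpha>, f \<beta>) | \<alpha> \<beta>. (\<alpha>, \<beta>) \<in> s} = \<phi> s))"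

text \<open>Points of the Cartesian power are lists of length \<open>m\<close>, and \<open>tuple_rel [s\<^sub>1, \<dots>, s\<^sub>m]\<close> is
  \<open>s\<^sub>1 \<times> \<dots> \<times> s\<^sub>m\<close> read as a relation between such lists.\<close>

definition tuples :: "nat \<Rightarrow> 'a set \<Rightarrow> 'a list set" where
  "tuples m A = {xs. length xs = m \<and> set xs \<subseteq> A}"

definition tuple_rel :: "'a rel list \<Rightarrow> 'a list rel" where
  "tuple_rel ss = {(xs, ys). length xs = length ss \<and> length ys = length ss \<and>
                             (\<forall>i < length ss. (xs ! i, ys ! i) \<in> ss ! i)}"

definition cartesian_power :: "nat \<Rightarrow> 'a config \<Rightarrow> 'a list config" where
  "cartesian_power m X = (tuples m (points X), tuple_rel ` tuples m (basis X))"

definition diag :: "nat \<Rightarrow> 'a set \<Rightarrow> 'a list set" where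
  "diag m A = {replicate m \<alpha> | \<alpha>. \<alpha> \<in> A}"

definition m_extension :: "nat \<Rightarrow> 'a config \<Rightarrow> 'a list config" where
  "m_extension m X =
     smallest_config (\<lambda>Y. cartesian_power m X \<sqsubseteq>\<^sub>c Y \<and>
                          (\<exists>F \<subseteq> fibers Y. diag m (points X) = \<Union>F))"

definition m_dimensional :: "nat \<Rightarrow> 'a config \<Rightarrow> 'b config \<Rightarrow> ('a rel \<Rightarrow> 'b rel) \<Rightarrow> bool" where
  "m_dimensional m X X' \<phi> \<longleftrightarrow>
     (\<exists>\<psi>. algebraic_iso (m_extension m X) (m_extension m X') \<psi> \<and>
          rel_ext (m_extension m X) \<psi> (Id_on (diag m (points X))) = Id_on (diag m (points X')) \<and>
          (\<forall>ss \<in> tuples m (basis X).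
             rel_ext (m_extension m X) \<psi> (tuple_rel ss) = tuple_rel (map \<phi> ss)))"

text \<open>The definiens of a constant cannot quantify over types, so the type \<open>'b\<close> of the points of the
  second configuration is a parameter. A theorem in which \<open>'b\<close> is a free type variable covers
  coherent configurations on sets of any type.\<close>

definition m_separable :: "'b itself \<Rightarrow> nat \<Rightarrow> 'a config \<Rightarrow> bool" where
  "m_separable _ m X \<longleftrightarrow>
     (\<forall>(X' :: 'b config) \<phi>.
        coherent_config X' \<and> algebraic_iso X X' \<phi> \<and> m_dimensional m X X' \<phi> \<longrightarrow>
        induced_by_iso X X' \<phi>)"


section \<open>The Cartan scheme of \<open>PSL(2,q)\<close>\<close>

definition SL2 :: "('f::field ^ 2 ^ 2) monoid" where
  "SL2 = \<lparr>carrier = {A. det A = 1}, monoid.mult = (**), one = mat 1\<rparr>"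

definition SL2_scalars :: "('f::field ^ 2 ^ 2) set" where
  "SL2_scalars = {A \<in> carrier SL2. \<exists>c. A = mat c}"

definition PSL2 :: "('f::field ^ 2 ^ 2) set monoid" where
  "PSL2 = SL2 Mod SL2_scalars"

definition SL2_diagonals :: "('f::field ^ 2 ^ 2) set" where
  "SL2_diagonals = {A \<in> carrier SL2. \<forall>i j. i \<noteq> j \<longrightarrow> A $ i $ j = 0}"

definition cartan_subgroup :: "('f::field ^ 2 ^ 2) set set" where
  "cartan_subgroup = (\<lambda>A. SL2_scalars #>\<^bsub>SL2\<^esub> A) ` SL2_diagonals"

text \<open>\<open>Inv(G, \<Omega>)\<close> for \<open>\<Omega>\<close> the right cosets of \<open>H\<close>, with \<open>G\<close> acting by right multiplication. The
  constant \<open>orbits\<close> only uses the set of maps, so a right action can be passed to it directly.\<close>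

definition coset_scheme :: "('g, 'm) monoid_scheme \<Rightarrow> 'g set \<Rightarrow> 'g set config" where
  "coset_scheme G H =
     (rcosets\<^bsub>G\<^esub> H,
      orbits G ((rcosets\<^bsub>G\<^esub> H) \<times> (rcosets\<^bsub>G\<^esub> H)) (\<lambda>g (A, B). (A #>\<^bsub>G\<^esub> g, B #>\<^bsub>G\<^esub> g)))"

definition cartan_scheme :: "('f::field ^ 2 ^ 2) set set config" where
  "cartan_scheme = coset_scheme PSL2 cartan_subgroup"

end

theory Submission
  imports Defs
begin

text \<open>A point of the Cartan scheme is an ordered pair of distinct points of the projective line, and
  the orbit of a pair of points determines a cross ratio. Fix \<open>\<alpha>\<close>. For suitable \<open>\<beta>\<close>, \<open>\<gamma>\<close> the
  relations of \<open>(\<alpha>, \<gamma>)\<close> and \<open>(\<beta>, \<gamma>)\<close> determine \<open>\<gamma>\<close>, because the cross ratio is injective on the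
  orbit of \<open>\<gamma>\<close> under the stabilizer of \<open>\<alpha>\<close>. A suitable \<open>\<beta>\<close> reaches every point in at most two such
  steps. Hence, in any coherent configuration above the scheme that fixes \<open>\<alpha>\<close>, the basis relation of
  \<open>(\<beta>, \<gamma>)\<close> has valency one at \<open>\<beta>\<close>, for all \<open>\<gamma>\<close>. This makes \<open>{\<alpha>, \<beta>}\<close> a base. In the 2-extension,
  where the points \<open>(\<alpha>, \<gamma>)\<close> form a copy of the point extension at \<open>\<alpha>\<close>, it lets an algebraic
  isomorphism transport \<open>\<gamma>\<close> to a unique point, which gives the inducing bijection. One point is not
  a base, since the Cartan subgroup fixes \<open>\<alpha>\<close> and is nontrivial for \<open>q > 3\<close>.\<close>

section \<open>Coherent configurations and their relation algebras\<close>

text \<open>For a partition \<open>R\<close> this is the block of \<open>p\<close>. For a finite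
  family closed under intersections it is the smallest member containing \<open>p\<close>; coherent
  algebras are treated in this second reading.\<close>

definition cell :: "'a rel set \<Rightarrow> 'a \<times> 'a \<Rightarrow> 'a rel" where
  "cell R p = \<Inter>{r \<in> R. p \<in> r}"

lemma cell_eq:
  assumes "partition_on A P" and "s \<in> P" and "p \<in> s"
  shows "cell P p = s"
proof -
  have "{r \<in> P. p \<in> r} = {s}"
    using assms unfolding partition_on_def disjoint_def by blast
  then show ?thesis by (simp add: cell_def)
qed

lemma cell_mem:
  assumes "partition_on A P" and "p \<in> A"
  shows "cell P p \<in> P" and "p \<in> cell P p"
proof -
  obtain s where "s \<in> P" "p \<in> s"
    using assms unfolding partition_on_def by blast
  then show "cell P p \<in> P" and "p \<in> cell P p"
    using cell_eq[OF assms(1)] by auto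
qed

text \<open>Being a union of blocks becomes a condition that is checked point by point; the witness
  is the set of cells of the points of \<open>r\<close>.\<close>

lemma partition_subset_iff:
  assumes "partition_on A P"
  shows "(\<exists>T \<subseteq> P. r = \<Union>T) \<longleftrightarrow> r \<subseteq> A \<and> (\<forall>p \<in> r. cell P p \<subseteq> r)"
proof
  assume "\<exists>T \<subseteq> P. r = \<Union>T"
  then show "r \<subseteq> A \<and> (\<forall>p \<in> r. cell P p \<subseteq> r)"
    using cell_eq[OF assms] partition_onD1[OF assms] by blast
next
  assume r: "r \<subseteq> A \<and> (\<forall>p \<in> r. cell P p \<subseteq> r)"
  then have "r = \<Union>(cell P ` r)" and "cell P ` r \<subseteq> P"
    using cell_mem[OF assms] by blast+
  then show "\<exists>T \<subseteq> P. r = \<Union>T" by metis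
qed

section \<open>Relations, intersection numbers and paths in a coherent configuration\<close>

lemma coherent_finite: "coherent_config X \<Longrightarrow> finite (points X)"
  by (simp add: coherent_config_def)

lemma coherent_partition:
  "coherent_config X \<Longrightarrow> partition_on (points X \<times> points X) (basis X)"
  by (simp add: coherent_config_def)

lemma relations_iff:
  assumes "coherent_config X"
  shows "r \<in> relations X \<longleftrightarrow>
    r \<subseteq> points X \<times> points X \<and> (\<forall>p \<in> r. cell (basis X) p \<subseteq> r)"
  unfolding partition_subset_iff[OF coherent_partition[OF assms], symmetric] relations_def
  by blast

lemma basis_subset_relations: "s \<in> basis X \<Longrightarrow> s \<in> relations X"
  unfolding relations_def by (rule CollectI, rule exI[of _ "{s}"]) auto

lemma coherent_card_eq:
  assumes "coherent_config X" and "r \<in> basis X" and "s \<in> basis X" and "t \<in> basis X"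
    and "(x, y) \<in> t" and "(x', y') \<in> t"
  shows "card (r `` {x} \<inter> s\<inverse> `` {y}) = card (r `` {x'} \<inter> s\<inverse> `` {y'})"
proof -
  obtain n where "\<forall>(\<alpha>, \<beta>) \<in> t. card (r `` {\<alpha>} \<inter> s\<inverse> `` {\<beta>}) = n"
    using assms(1-4) unfolding coherent_config_def by blast
  then have "card (r `` {x} \<inter> s\<inverse> `` {y}) = n" "card (r `` {x'} \<inter> s\<inverse> `` {y'}) = n"
    using assms(5,6) by fast+
  then show ?thesis by simp
qed

text \<open>Nonemptiness of \<open>t\<close> makes the described number unique. The form for plain
  relations lets \<open>algebraic_iso_Id\<close> apply it to a family known only to be a
  partition.\<close>

lemma intersection_number_eqI:
  assumes "\<And>x y. (x, y) \<in> t \<Longrightarrow> card (r `` {x} \<inter> s\<inverse> `` {y}) = n" and "t \<noteq> {}"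
  shows "intersection_number r s t = n"
  unfolding intersection_number_def
proof (rule the_equality)
  show "\<forall>(x, y) \<in> t. card (r `` {x} \<inter> s\<inverse> `` {y}) = n" using assms by blast
next
  fix m assume m: "\<forall>(x, y) \<in> t. card (r `` {x} \<inter> s\<inverse> `` {y}) = m"
  obtain x y where "(x, y) \<in> t" using assms(2) by auto
  then show "m = n" using m assms(1) by fastforce
qed

lemma intersection_number_eq:
  assumes "coherent_config X" and "r \<in> basis X" and "s \<in> basis X" and "t \<in> basis X"
    and "(x, y) \<in> t"
  shows "intersection_number r s t = card (r `` {x} \<inter> s\<inverse> `` {y})"
proof (rule intersection_number_eqI)
  show "card (r `` {x'} \<inter> s\<inverse> `` {y'}) = card (r `` {x} \<inter> s\<inverse> `` {y})" if "(x', y') \<in> t" for x' y'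
    by (rule coherent_card_eq[OF assms(1-4) that assms(5)])
  show "t \<noteq> {}" using assms(5) by auto
qed

lemma basis_subset:
  "\<lbrakk>coherent_config X; s \<in> basis X\<rbrakk> \<Longrightarrow> s \<subseteq> points X \<times> points X"
  using coherent_partition partition_onD1 by blast

lemma finite_basis_image:
  assumes "coherent_config X" and "s \<in> basis X"
  shows "finite (s `` {x})"
  using finite_subset[OF _ coherent_finite[OF assms(1)]] basis_subset[OF assms] by blast

text \<open>Algebraic isomorphisms preserve only numbers. Translating a nonzero number into a path
  of length two and back is what lets them transport paths.\<close>

lemma intersection_number_pos:
  assumes "coherent_config X" and "r \<in> basis X" and "s \<in> basis X" and "t \<in> basis X"
    and "(x, y) \<in> t"
  shows "intersection_number r s t \<noteq> 0 \<longleftrightarrow> (\<exists>z. (x, z) \<in> r \<and> (z, y) \<in> s)"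
  using finite_basis_image[OF assms(1,2)]
  by (auto simp: intersection_number_eq[OF assms] card_eq_0_iff)

text \<open>The intersection number belonging to the two legs through \<open>z\<close> is nonzero at
  \<open>(x, y)\<close>, hence also at \<open>(x', y')\<close>: a path of length two has a copy over
  every pair of the same basis relation.\<close>

lemma coherent_path:
  assumes "coherent_config X" and "t \<in> basis X" "(x, y) \<in> t" "(x', y') \<in> t"
    and "x \<in> points X" "y \<in> points X" and "z \<in> points X"
  obtains z' where "(x', z') \<in> cell (basis X) (x, z)" "(z', y') \<in> cell (basis X) (z, y)"
proof -
  note cm = cell_mem[OF coherent_partition[OF assms(1)]]
  have "\<exists>w. (x, w) \<in> cell (basis X) (x, z) \<and> (w, y) \<in> cell (basis X) (z, y)"
    using cm assms by (meson mem_Sigma_iff)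
  then show ?thesis
    using intersection_number_pos[OF assms(1) _ _ assms(2), of "cell (basis X) (x, z)" "cell (basis X) (z, y)"]
      cm(1)[of "(x, z)"] cm(1)[of "(z, y)"] assms that by (metis mem_Sigma_iff)
qed

text \<open>For finite \<Omega> the adjacency matrices of the members are the zero-one matrices of a
  coherent algebra. Constancy of intersection numbers on basis relations is replaced by membership
  of the level sets of the counts, so that every condition survives intersections of
  families.\<close>

definition coherent_algebra :: "'a set \<Rightarrow> 'a rel set \<Rightarrow> bool" where
  "coherent_algebra \<Omega> R \<longleftrightarrow>
     R \<subseteq> Pow (\<Omega> \<times> \<Omega>) \<and> Id_on \<Omega> \<in> R \<and> \<Omega> \<times> \<Omega> \<in> R \<and>
     (\<forall>r \<in> R. \<forall>s \<in> R. r \<union> s \<in> R) \<and> (\<forall>r \<in> R. \<forall>s \<in> R. r - s \<in> R) \<and>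
     (\<forall>r \<in> R. r\<inverse> \<in> R) \<and>
     (\<forall>r \<in> R. \<forall>s \<in> R. \<forall>n. {(x, y) \<in> \<Omega> \<times> \<Omega>. card (r `` {x} \<inter> s\<inverse> `` {y}) = n} \<in> R)"

lemma coherent_algebraI:
  assumes "\<And>r. r \<in> R \<Longrightarrow> r \<subseteq> \<Omega> \<times> \<Omega>" and "Id_on \<Omega> \<in> R" and "\<Omega> \<times> \<Omega> \<in> R"
    and "\<And>r s. \<lbrakk>r \<in> R; s \<in> R\<rbrakk> \<Longrightarrow> r \<union> s \<in> R" and "\<And>r s. \<lbrakk>r \<in> R; s \<in> R\<rbrakk> \<Longrightarrow> r - s \<in> R"
    and "\<And>r. r \<in> R \<Longrightarrow> r\<inverse> \<in> R"
    and "\<And>r s n. \<lbrakk>r \<in> R; s \<in> R\<rbrakk> \<Longrightarrow>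
      {(x, y) \<in> \<Omega> \<times> \<Omega>. card (r `` {x} \<inter> s\<inverse> `` {y}) = n} \<in> R"
  shows "coherent_algebra \<Omega> R"
  unfolding coherent_algebra_def by (intro conjI ballI allI subsetI PowI assms)

lemma coherent_algebra_Inter:
  assumes "\<And>R. R \<in> C \<Longrightarrow> coherent_algebra \<Omega> R" and "C \<noteq> {}"
  shows "coherent_algebra \<Omega> (\<Inter>C)"
  using assms unfolding coherent_algebra_def by (intro conjI) blast+

lemma coherent_algebra_Pow: "coherent_algebra \<Omega> (Pow (\<Omega> \<times> \<Omega>))"
  unfolding coherent_algebra_def by auto

text \<open>A permutation \<open>h\<close> carries the common neighbours of \<open>x\<close> and
  \<open>y\<close> onto those of \<open>h x\<close> and \<open>h y\<close>, so the counts are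
  invariant. This algebra later bounds point extensions from above.\<close>

lemma coherent_algebra_invariant:
  assumes "bij_betw h \<Omega> \<Omega>"
  shows "coherent_algebra \<Omega>
    {r. r \<subseteq> \<Omega> \<times> \<Omega> \<and> (\<forall>x \<in> \<Omega>. \<forall>y \<in> \<Omega>. (h x, h y) \<in> r \<longleftrightarrow> (x, y) \<in> r)}" (is "coherent_algebra \<Omega> ?R")
proof -
  have inj: "inj_on h \<Omega>" and im: "h ` \<Omega> = \<Omega>"
    using assms by (auto simp: bij_betw_def)
  have inv: "card (r `` {h x} \<inter> s\<inverse> `` {h y}) = card (r `` {x} \<inter> s\<inverse> `` {y})"
    if r: "r \<in> ?R" and s: "s \<in> ?R" and x: "x \<in> \<Omega>" and y: "y \<in> \<Omega>" for r s x y
  proof -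
    have sub: "r `` {x} \<inter> s\<inverse> `` {y} \<subseteq> \<Omega>" using r by auto
    have "h ` (r `` {x} \<inter> s\<inverse> `` {y}) = r `` {h x} \<inter> s\<inverse> `` {h y}"
    proof
      show "h ` (r `` {x} \<inter> s\<inverse> `` {y}) \<subseteq> r `` {h x} \<inter> s\<inverse> `` {h y}"
        using r s x y by auto
      show "r `` {h x} \<inter> s\<inverse> `` {h y} \<subseteq> h ` (r `` {x} \<inter> s\<inverse> `` {y})"
      proof
        fix z assume z: "z \<in> r `` {h x} \<inter> s\<inverse> `` {h y}"
        then have "z \<in> \<Omega>" using r by auto
        then obtain w where "w \<in> \<Omega>" "z = h w" using im by blast
        then show "z \<in> h ` (r `` {x} \<inter> s\<inverse> `` {y})" using z r s x y by auto
      qed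
    qed
    then show ?thesis
      using card_image[OF inj_on_subset[OF inj sub]] by simp
  qed
  have mem: "h x \<in> \<Omega>" if "x \<in> \<Omega>" for x using im that by blast
  have "(h x, h y) \<in> Id_on \<Omega> \<longleftrightarrow> (x, y) \<in> Id_on \<Omega>" if "x \<in> \<Omega>" "y \<in> \<Omega>" for x y
    using inj_on_eq_iff[OF inj that] mem that by (simp add: Id_on_iff)
  then have Id: "Id_on \<Omega> \<in> ?R" by auto
  have level: "{(x, y) \<in> \<Omega> \<times> \<Omega>. card (r `` {x} \<inter> s\<inverse> `` {y}) = n} \<in> ?R"
    if "r \<in> ?R" "s \<in> ?R" for r s n
    using inv[OF that] mem by auto
  show ?thesis
    by (rule coherent_algebraI[OF _ Id _ _ _ _ level]) (use mem in auto)
qed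

text \<open>The count for two relations is the sum of the counts for the pairs of basis relations
  inside them: distinct pairs contribute disjoint sets, because the middle point determines both
  basis relations. Each summand is constant on basis relations, so the level sets of the sum are
  unions of basis relations.\<close>

lemma coherent_algebra_relations:
  assumes X: "coherent_config X"
  shows "coherent_algebra (points X) (relations X)"
proof -
  let ?O = "points X" and ?B = "basis X"
  note part = coherent_partition[OF X]
  note ri = relations_iff[OF X]
  have finB: "finite ?B"
    using finite_elements[OF _ part] coherent_finite[OF X] by simp
  have cell_eq': "cell ?B q = cell ?B p" if "q \<in> cell ?B p" "p \<in> ?O \<times> ?O" for p q
    using cell_eq[OF part cell_mem(1)[OF part that(2)] that(1)] .
  have card_sum: "card (r `` {x} \<inter> s\<inverse> `` {y}) =
      (\<Sum>(r0, s0) \<in> {r0 \<in> ?B. r0 \<subseteq> r} \<times> {s0 \<in> ?B. s0 \<subseteq> s}. card (r0 `` {x} \<inter> s0\<inverse> `` {y}))"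
    if r: "r \<in> relations X" and s: "s \<in> relations X" for r s x y
  proof -
    let ?I = "{r0 \<in> ?B. r0 \<subseteq> r} \<times> {s0 \<in> ?B. s0 \<subseteq> s}"
    let ?f = "\<lambda>(r0, s0). r0 `` {x} \<inter> s0\<inverse> `` {y}"
    have cov: "\<exists>u0 \<in> ?B. u0 \<subseteq> u \<and> p \<in> u0" if "u \<in> relations X" "p \<in> u" for u p
      using that unfolding relations_def by blast
    have "r `` {x} \<inter> s\<inverse> `` {y} = (\<Union>i \<in> ?I. ?f i)"
      using cov[OF r] cov[OF s] by fastforce
    moreover have "card (\<Union>i \<in> ?I. ?f i) = (\<Sum>i \<in> ?I. card (?f i))"
    proof (rule card_UN_disjoint)
      show "finite ?I" using finB by auto
      show "\<forall>i \<in> ?I. finite (?f i)" using finite_basis_image[OF X] by auto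
      show "\<forall>i \<in> ?I. \<forall>j \<in> ?I. i \<noteq> j \<longrightarrow> ?f i \<inter> ?f j = {}"
      proof (intro ballI impI)
        fix i j assume i: "i \<in> ?I" and j: "j \<in> ?I" and ne: "i \<noteq> j"
        have "i = j" if "z \<in> ?f i \<inter> ?f j" for z
        proof -
          have "(x, z) \<in> fst i" "(x, z) \<in> fst j" "(z, y) \<in> snd i" "(z, y) \<in> snd j"
            using that by (auto split: prod.splits)
          moreover have "fst i \<in> ?B" "fst j \<in> ?B" "snd i \<in> ?B" "snd j \<in> ?B"
            using i j by auto
          ultimately have "fst i = fst j" "snd i = snd j"
            using cell_eq[OF part] by metis+
          then show ?thesis by (simp add: prod_eq_iff)
        qed
        then show "?f i \<inter> ?f j = {}" using ne by blast
      qed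
    qed
    ultimately show ?thesis by (simp add: case_prod_unfold)
  qed
  have level: "{(x, y) \<in> ?O \<times> ?O. card (r `` {x} \<inter> s\<inverse> `` {y}) = n} \<in> relations X"
    if r: "r \<in> relations X" and s: "s \<in> relations X" for r s n
    unfolding ri
  proof (intro conjI ballI)
    fix p assume p: "p \<in> {(x, y) \<in> ?O \<times> ?O. card (r `` {x} \<inter> s\<inverse> `` {y}) = n}"
    then have p2: "p \<in> ?O \<times> ?O" by auto
    show "cell ?B p \<subseteq> {(x, y) \<in> ?O \<times> ?O. card (r `` {x} \<inter> s\<inverse> `` {y}) = n}"
    proof
      fix q assume q: "q \<in> cell ?B p"
      have "card (r `` {fst p} \<inter> s\<inverse> `` {snd p}) = card (r `` {fst q} \<inter> s\<inverse> `` {snd q})"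
        unfolding card_sum[OF r s]
        using coherent_card_eq[OF X _ _ cell_mem(1)[OF part p2], of _ _ "fst p" "snd p" "fst q" "snd q"]
          cell_mem(2)[OF part p2] q
        by (intro sum.cong) auto
      moreover have "q \<in> ?O \<times> ?O" using q cell_mem(1)[OF part p2] basis_subset[OF X] by blast
      ultimately show "q \<in> {(x, y) \<in> ?O \<times> ?O. card (r `` {x} \<inter> s\<inverse> `` {y}) = n}"
        using p by auto
    qed
  qed auto
  have diff: "r - s \<in> relations X" if "r \<in> relations X" "s \<in> relations X" for r s
    unfolding ri
  proof (intro conjI ballI)
    show "r - s \<subseteq> ?O \<times> ?O" using that(1) ri by blast
    fix p assume p: "p \<in> r - s"
    then have pO: "p \<in> ?O \<times> ?O" and pr: "cell ?B p \<subseteq> r" using that(1) ri by blast+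
    have False if q: "q \<in> cell ?B p" "q \<in> s" for q
    proof -
      have "cell ?B q \<subseteq> s" using \<open>s \<in> relations X\<close> q(2) ri by blast
      then have "p \<in> s" using cell_eq'[OF q(1) pO] cell_mem(2)[OF part pO] by auto
      then show False using p by simp
    qed
    then show "cell ?B p \<subseteq> r - s" using pr by blast
  qed
  have full: "?O \<times> ?O \<in> relations X"
    unfolding ri using cell_mem(1)[OF part] basis_subset[OF X] by blast
  have un: "r \<union> s \<in> relations X" if "r \<in> relations X" "s \<in> relations X" for r s
    using that unfolding ri by blast
  have conv: "r\<inverse> \<in> relations X" if r: "r \<in> relations X" for r
  proof -
    obtain T where T: "T \<subseteq> ?B" "r = \<Union>T" using r unfolding relations_def by blast
    then have "r\<inverse> = \<Union>(converse ` T)" by auto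
    moreover have "converse ` T \<subseteq> ?B" using T X unfolding coherent_config_def by blast
    ultimately show ?thesis unfolding relations_def by blast
  qed
  have Id: "Id_on ?O \<in> relations X" using X by (simp add: coherent_config_def)
  show ?thesis
    by (rule coherent_algebraI[OF _ Id full un diff conv level]) (use ri in blast)
qed

lemma coherent_algebra_Inter_closed:
  assumes R: "coherent_algebra \<Omega> R" and "finite T" and "T \<noteq> {}" and "T \<subseteq> R"
  shows "\<Inter>T \<in> R"
  using assms(2-4)
proof (induction rule: finite_ne_induct)
  case (insert s T)
  have "s \<inter> \<Inter>T = s - (s - \<Inter>T)" by blast
  moreover have "\<forall>r \<in> R. \<forall>s \<in> R. r - s \<in> R" using R by (simp add: coherent_algebra_def)
  ultimately show ?case using insert by simp
qed auto

text \<open>The basis relations are the atoms of \<open>R\<close> as a finite Boolean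
  algebra.\<close>

definition algebra_config :: "'a set \<Rightarrow> 'a rel set \<Rightarrow> 'a config" where
  "algebra_config \<Omega> R = (\<Omega>, cell R ` (\<Omega> \<times> \<Omega>))"

lemma points_algebra_config [simp]: "points (algebra_config \<Omega> R) = \<Omega>"
  by (simp add: algebra_config_def)

lemma
  assumes R: "coherent_algebra \<Omega> R" and fin: "finite \<Omega>"
  shows coherent_algebra_config: "coherent_config (algebra_config \<Omega> R)"
    and relations_algebra_config: "relations (algebra_config \<Omega> R) = R"
proof -
  let ?B = "cell R ` (\<Omega> \<times> \<Omega>)"
  have diff: "r - s \<in> R" if "r \<in> R" "s \<in> R" for r s using R that by (simp add: coherent_algebra_def)
  have un: "r \<union> s \<in> R" if "r \<in> R" "s \<in> R" for r s using R that by (simp add: coherent_algebra_def)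
  have conv: "r\<inverse> \<in> R" if "r \<in> R" for r using R that by (simp add: coherent_algebra_def)
  have sub: "R \<subseteq> Pow (\<Omega> \<times> \<Omega>)" and full: "\<Omega> \<times> \<Omega> \<in> R" and Id: "Id_on \<Omega> \<in> R"
    using R by (auto simp: coherent_algebra_def)
  have finR: "finite R" using sub fin by (meson finite_Pow_iff finite_SigmaI finite_subset)
  have cellR: "cell R p \<in> R" and cellp: "p \<in> cell R p" if "p \<in> \<Omega> \<times> \<Omega>" for p
  proof -
    show "cell R p \<in> R" unfolding cell_def
      by (rule coherent_algebra_Inter_closed[OF R]) (use finR full that in auto)
    show "p \<in> cell R p" by (simp add: cell_def)
  qed
  have atom: "cell R p \<subseteq> r" if "r \<in> R" "p \<in> r" for p r
    using that by (auto simp: cell_def)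
  have cell_q: "cell R q = cell R p" if p: "p \<in> \<Omega> \<times> \<Omega>" and q: "q \<in> cell R p" for p q
  proof
    have qO: "q \<in> \<Omega> \<times> \<Omega>" using q cellR[OF p] sub by blast
    show "cell R q \<subseteq> cell R p" by (rule atom[OF cellR[OF p] q])
    \<comment> \<open>Otherwise \<open>cell R p - cell R q\<close> would be a member of
      \<open>R\<close> that contains \<open>p\<close> and is smaller than the cell of
      \<open>p\<close>.\<close>
    have "p \<in> cell R q"
    proof (rule ccontr)
      assume "p \<notin> cell R q"
      then have "p \<in> cell R p - cell R q" using cellp[OF p] by simp
      then have "cell R p \<subseteq> cell R p - cell R q" using atom diff cellR p qO by metis
      then show False using q cellp[OF qO] by blast
    qed
    then show "cell R p \<subseteq> cell R q" by (rule atom[OF cellR[OF qO]])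
  qed
  have part: "partition_on (\<Omega> \<times> \<Omega>) ?B"
    unfolding partition_on_def
  proof (intro conjI)
    show "\<Union>?B = \<Omega> \<times> \<Omega>"
    proof
      show "\<Union>?B \<subseteq> \<Omega> \<times> \<Omega>" using cellR sub by blast
      show "\<Omega> \<times> \<Omega> \<subseteq> \<Union>?B" using cellp by blast
    qed
    show "disjoint ?B" unfolding disjoint_def using cell_q by blast
    show "{} \<notin> ?B" using cellp by blast
  qed
  have cellB: "cell ?B p = cell R p" if "p \<in> \<Omega> \<times> \<Omega>" for p
    by (rule cell_eq[OF part]) (use that cellp in auto)
  have rel: "\<Union>T \<in> R" if "T \<subseteq> ?B" for T
  proof -
    have "finite T" using that fin by (meson finite_SigmaI finite_imageI finite_subset)
    then show ?thesis using that
    proof (induction rule: finite_induct)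
      case empty
      then show ?case using diff[OF full full] by simp
    next
      case (insert x F)
      then show ?case using un cellR by auto
    qed
  qed
  show relR: "relations (algebra_config \<Omega> R) = R"
  proof
    show "relations (algebra_config \<Omega> R) \<subseteq> R"
      using rel unfolding relations_def algebra_config_def by auto
    show "R \<subseteq> relations (algebra_config \<Omega> R)"
    proof
      fix r assume r: "r \<in> R"
      then have rO: "r \<subseteq> \<Omega> \<times> \<Omega>" using sub by blast
      have "r = \<Union>(cell R ` r)" using atom[OF r] cellp rO by blast
      moreover have "cell R ` r \<subseteq> ?B" using rO by blast
      ultimately show "r \<in> relations (algebra_config \<Omega> R)"
        unfolding relations_def algebra_config_def snd_conv
        by (intro CollectI exI[of _ "cell R ` r"] conjI)
    qed
  qed
  \<comment> \<open>Converse is an involution on \<open>R\<close>, so it maps atoms to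
    atoms.\<close>
  have convB: "s\<inverse> \<in> ?B" if s: "s \<in> ?B" for s
  proof -
    obtain x y where xy: "(x, y) \<in> \<Omega> \<times> \<Omega>" and s: "s = cell R (x, y)" using s by auto
    then have yx: "(y, x) \<in> \<Omega> \<times> \<Omega>" by auto
    have "cell R (y, x) \<subseteq> s\<inverse>" using atom[OF conv[OF cellR[OF xy]]] cellp[OF xy] s by auto
    moreover have "s \<subseteq> (cell R (y, x))\<inverse>" unfolding s
      using atom[OF conv[OF cellR[OF yx]]] cellp[OF yx] by auto
    ultimately have "s\<inverse> = cell R (y, x)" by auto
    then show ?thesis using yx by blast
  qed
  have const: "\<exists>n. \<forall>(x, y) \<in> t. card (r `` {x} \<inter> s\<inverse> `` {y}) = n"
    if "r \<in> ?B" "s \<in> ?B" "t \<in> ?B" for r s t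
  proof -
    obtain x y where xy: "(x, y) \<in> \<Omega> \<times> \<Omega>" and t: "t = cell R (x, y)" using \<open>t \<in> ?B\<close> by auto
    \<comment> \<open>The level set of the count attained at \<open>(x, y)\<close> is a member of
      \<open>R\<close>, hence includes the whole atom of \<open>(x, y)\<close>.\<close>
    let ?L = "{(x', y') \<in> \<Omega> \<times> \<Omega>. card (r `` {x'} \<inter> s\<inverse> `` {y'}) = card (r `` {x} \<inter> s\<inverse> `` {y})}"
    have "r \<in> R" "s \<in> R" using that cellR by auto
    then have "?L \<in> R" using R unfolding coherent_algebra_def by blast
    then have "t \<subseteq> ?L" unfolding t using xy by (intro atom) auto
    then show ?thesis by blast
  qed
  show "coherent_config (algebra_config \<Omega> R)"
    unfolding coherent_config_def relR
    unfolding algebra_config_def fst_conv snd_conv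
    by (intro conjI ballI fin part Id convB const)
qed

text \<open>The basis relations can be recovered as the minimal nonempty relations. This gives the
  uniqueness that the definite description in \<open>smallest_config\<close> asks for.\<close>

lemma coherent_config_eqI:
  assumes X: "coherent_config X" and Y: "coherent_config Y"
    and pts: "points X = points Y" and rel: "relations X = relations Y"
  shows "X = Y"
proof -
  have sub: "basis U \<subseteq> basis V"
    if U: "coherent_config U" and V: "coherent_config V" and rel: "relations U = relations V"
    for U V :: "'a config"
  proof
    fix s assume s: "s \<in> basis U"
    then have "s \<noteq> {}" using coherent_partition[OF U] by (auto simp: partition_on_def)
    then obtain p where p: "p \<in> s" by auto
    have sV: "s \<in> relations V" using basis_subset_relations[OF s] rel by simp
    then have pV: "p \<in> points V \<times> points V" and cs: "cell (basis V) p \<subseteq> s"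
      using p relations_iff[OF V] by blast+
    note c = cell_mem[OF coherent_partition[OF V] pV]
    have "cell (basis U) p = s" using cell_eq[OF coherent_partition[OF U] s p] .
    moreover have "cell (basis V) p \<in> relations U" using basis_subset_relations[OF c(1)] rel by simp
    ultimately have "s \<subseteq> cell (basis V) p" using relations_iff[OF U] c(2) by blast
    then show "s \<in> basis V" using cs c(1) by (metis subset_antisym)
  qed
  show ?thesis
    using sub[OF X Y rel] sub[OF Y X rel[symmetric]] pts by (simp add: prod_eq_iff)
qed

text \<open>The families of relations of coherent configurations are exactly the coherent algebras, and
  these are closed under intersection: this is why smallest configurations exist.\<close>

lemma smallest_config:
  assumes fin: "finite \<Omega>" and K: "K \<subseteq> Pow (\<Omega> \<times> \<Omega>)"
    and P: "\<And>Y. coherent_config Y \<Longrightarrow> P Y \<longleftrightarrow> points Y = \<Omega> \<and> K \<subseteq> relations Y"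
  shows "coherent_config (smallest_config P)" and "P (smallest_config P)"
    and "\<And>Y. \<lbrakk>coherent_config Y; P Y\<rbrakk> \<Longrightarrow> smallest_config P \<sqsubseteq>\<^sub>c Y"
proof -
  let ?C = "{R. coherent_algebra \<Omega> R \<and> K \<subseteq> R}"
  let ?M = "algebra_config \<Omega> (\<Inter>?C)"
  \<comment> \<open>The algebra of all relations on \<Omega> is one candidate.\<close>
  have "?C \<noteq> {}" using coherent_algebra_Pow K by blast
  then have alg: "coherent_algebra \<Omega> (\<Inter>?C)" by (intro coherent_algebra_Inter) auto
  have M: "coherent_config ?M" "relations ?M = \<Inter>?C"
    using coherent_algebra_config[OF alg fin] relations_algebra_config[OF alg fin] .
  have PM: "P ?M" using P[OF M(1)] M(2) by auto
  have least: "?M \<sqsubseteq>\<^sub>c Y" if "coherent_config Y" "P Y" for Y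
    using that P coherent_algebra_relations[OF that(1)] M(2) unfolding config_le_def by auto
  have "smallest_config P = ?M"
    unfolding smallest_config_def
  proof (rule the_equality)
    show "coherent_config ?M \<and> P ?M \<and> (\<forall>Y. coherent_config Y \<and> P Y \<longrightarrow> ?M \<sqsubseteq>\<^sub>c Y)"
      using M PM least by blast
  next
    fix Z assume Z: "coherent_config Z \<and> P Z \<and> (\<forall>Y. coherent_config Y \<and> P Y \<longrightarrow> Z \<sqsubseteq>\<^sub>c Y)"
    then have "Z \<sqsubseteq>\<^sub>c ?M" and "?M \<sqsubseteq>\<^sub>c Z" using M(1) PM least by blast+
    then have "points Z = points ?M" "relations Z = relations ?M"
      unfolding config_le_def by blast+
    then show "Z = ?M" using coherent_config_eqI Z M(1) by blast
  qed
  then show "coherent_config (smallest_config P)" "P (smallest_config P)"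
    "\<And>Y. \<lbrakk>coherent_config Y; P Y\<rbrakk> \<Longrightarrow> smallest_config P \<sqsubseteq>\<^sub>c Y"
    using M PM least by auto
qed

lemma coherent_Id_on: "coherent_config Y \<Longrightarrow> Id_on (points Y) \<in> relations Y"
  by (simp add: coherent_config_def)

lemma cell_subset_relation:
  assumes "coherent_config Y" and "r \<in> relations Y" and "p \<in> r"
  shows "cell (basis Y) p \<subseteq> r"
  using relations_iff[OF assms(1)] assms(2,3) by blast

lemma cell_diagonal:
  assumes "coherent_config Y" and "x \<in> points Y"
  shows "cell (basis Y) (x, x) \<subseteq> Id"
  using cell_subset_relation[OF assms(1) coherent_Id_on[OF assms(1)], of "(x, x)"] assms(2) by auto

text \<open>Copy the path from \<open>x\<close> to \<open>y\<close> that stops at \<open>y\<close>: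
  its second leg lies in the diagonal, so the middle point of the copy is \<open>y'\<close>. Hence a
  basis relation determines the fiber of its targets.\<close>

lemma cell_target:
  assumes Y: "coherent_config Y" and "x \<in> points Y" and "y \<in> points Y"
    and xy': "(x', y') \<in> cell (basis Y) (x, y)"
  shows "(y', y') \<in> cell (basis Y) (y, y)"
proof -
  note c = cell_mem[OF coherent_partition[OF Y], of "(x, y)"]
  obtain z where "(z, y') \<in> cell (basis Y) (y, y)"
    by (rule coherent_path[OF Y c(1) c(2) xy', of y]) (use assms in auto)
  then show ?thesis using cell_diagonal[OF Y \<open>y \<in> points Y\<close>] by auto
qed

lemma cell_source:
  assumes Y: "coherent_config Y" and "x \<in> points Y" and "y \<in> points Y"
    and xy': "(x', y') \<in> cell (basis Y) (x, y)"
  shows "(x', x') \<in> cell (basis Y) (x, x)"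
proof -
  note c = cell_mem[OF coherent_partition[OF Y], of "(x, y)"]
  obtain z where "(x', z) \<in> cell (basis Y) (x, x)"
    by (rule coherent_path[OF Y c(1) c(2) xy', of x]) (use assms in auto)
  then show ?thesis using cell_diagonal[OF Y \<open>x \<in> points Y\<close>] by auto
qed

section \<open>Point extensions and extensions of Cartesian powers\<close>

lemma relations_subset_Pow:
  "\<Union>(basis X) \<subseteq> A \<Longrightarrow> relations X \<subseteq> Pow A"
  unfolding relations_def by blast

text \<open>The conditions on \<open>Y\<close> say exactly that its relations contain the fixed
  family \<open>?K\<close>, so the general existence result for smallest configurations
  applies.\<close>

lemma
  assumes fin: "finite (points X)" and sub: "\<Union>(basis X) \<subseteq> points X \<times> points X"
    and A: "A \<subseteq> points X"
  shows coherent_point_extension: "coherent_config (point_extension X A)"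
    and le_point_extension: "X \<sqsubseteq>\<^sub>c point_extension X A"
    and point_extension_fixes: "\<And>\<alpha>. \<alpha> \<in> A \<Longrightarrow> {(\<alpha>, \<alpha>)} \<in> relations (point_extension X A)"
    and point_extension_least: "\<And>Y. \<lbrakk>coherent_config Y; X \<sqsubseteq>\<^sub>c Y; \<And>\<alpha>. \<alpha> \<in> A \<Longrightarrow> {(\<alpha>, \<alpha>)} \<in> relations Y\<rbrakk>
      \<Longrightarrow> point_extension X A \<sqsubseteq>\<^sub>c Y"
proof -
  let ?P = "\<lambda>Y. X \<sqsubseteq>\<^sub>c Y \<and> (\<forall>\<alpha> \<in> A. {(\<alpha>, \<alpha>)} \<in> relations Y)"
  let ?K = "relations X \<union> (\<lambda>\<alpha>. {(\<alpha>, \<alpha>)}) ` A"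
  have K: "?K \<subseteq> Pow (points X \<times> points X)"
    using relations_subset_Pow[OF sub] A by auto
  have P: "?P Y \<longleftrightarrow> points Y = points X \<and> ?K \<subseteq> relations Y" for Y
    unfolding config_le_def by auto
  note * = smallest_config[OF fin K P]
  show "coherent_config (point_extension X A)" "X \<sqsubseteq>\<^sub>c point_extension X A"
    "\<And>\<alpha>. \<alpha> \<in> A \<Longrightarrow> {(\<alpha>, \<alpha>)} \<in> relations (point_extension X A)"
    unfolding point_extension_def using *(1,2) by blast+
  show "point_extension X A \<sqsubseteq>\<^sub>c Y"
    if "coherent_config Y" "X \<sqsubseteq>\<^sub>c Y" "\<And>\<alpha>. \<alpha> \<in> A \<Longrightarrow> {(\<alpha>, \<alpha>)} \<in> relations Y" for Y
    unfolding point_extension_def by (rule *(3)) (use that in blast)+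
qed

section \<open>The extension of a Cartesian power\<close>

lemma union_of_fibers_iff:
  assumes Y: "coherent_config Y"
  shows "(\<exists>F \<subseteq> fibers Y. D = \<Union>F) \<longleftrightarrow> Id_on D \<in> relations Y"
proof
  assume "\<exists>F \<subseteq> fibers Y. D = \<Union>F"
  then obtain F where F: "F \<subseteq> fibers Y" "D = \<Union>F" by blast
  have "Id_on D = \<Union>(Id_on ` F)" unfolding F(2) by (auto simp: Id_on_iff)
  moreover have "Id_on ` F \<subseteq> basis Y" using F(1) by (auto simp: fibers_def)
  ultimately show "Id_on D \<in> relations Y" unfolding relations_def by blast
next
  assume "Id_on D \<in> relations Y"
  then obtain T where T: "T \<subseteq> basis Y" "Id_on D = \<Union>T" unfolding relations_def by blast
  \<comment> \<open>A part of the diagonal is the identity on its domain, so each block of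
    \<open>T\<close> comes from a fiber.\<close>
  have Id: "t = Id_on (Domain t)" if "t \<in> T" for t
  proof -
    have "t \<subseteq> Id_on D" using that T(2) by blast
    then have "t \<subseteq> Id" by auto
    then show ?thesis by auto
  qed
  have "Domain ` T \<subseteq> fibers Y"
  proof
    fix G assume "G \<in> Domain ` T"
    then obtain t where t: "t \<in> T" "G = Domain t" by blast
    then have "t \<in> basis Y" using T(1) by blast
    then show "G \<in> fibers Y"
      using Id[OF t(1)] t(2) basis_subset[OF Y] unfolding fibers_def by auto
  qed
  moreover have "D = \<Union>(Domain ` T)"
  proof -
    have "D = Domain (Id_on D)" by auto
    then show ?thesis unfolding T(2) by auto
  qed
  ultimately show "\<exists>F \<subseteq> fibers Y. D = \<Union>F" by metis
qed

lemma finite_tuples: "finite A \<Longrightarrow> finite (tuples m A)"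
  unfolding tuples_def using finite_lists_length_eq[of A m] by (simp add: conj_commute)

lemma
  assumes fin: "finite (points X)" and sub: "\<Union>(basis X) \<subseteq> points X \<times> points X"
  shows coherent_m_extension: "coherent_config (m_extension m X)"
    and le_m_extension: "cartesian_power m X \<sqsubseteq>\<^sub>c m_extension m X"
    and m_extension_diag: "Id_on (diag m (points X)) \<in> relations (m_extension m X)"
proof -
  let ?T = "tuples m (points X)"
  let ?P = "\<lambda>Y. cartesian_power m X \<sqsubseteq>\<^sub>c Y \<and> (\<exists>F \<subseteq> fibers Y. diag m (points X) = \<Union>F)"
  let ?K = "insert (Id_on (diag m (points X))) (relations (cartesian_power m X))"
  have "tuple_rel ss \<subseteq> ?T \<times> ?T" if ss: "ss \<in> tuples m (basis X)" for ss
  proof (rule subsetI, clarify)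
    fix xs ys assume xy: "(xs, ys) \<in> tuple_rel ss"
    have len: "length xs = m" "length ys = m" "length ss = m"
      using xy ss by (auto simp: tuple_rel_def tuples_def)
    have "xs ! i \<in> points X \<and> ys ! i \<in> points X" if "i < m" for i
    proof -
      have "(xs ! i, ys ! i) \<in> ss ! i" using xy len that by (auto simp: tuple_rel_def)
      moreover have "ss ! i \<in> basis X" using ss that by (auto simp: tuples_def)
      ultimately show ?thesis using sub by blast
    qed
    then show "xs \<in> ?T \<and> ys \<in> ?T" using len by (auto simp: tuples_def in_set_conv_nth)
  qed
  then have "relations (cartesian_power m X) \<subseteq> Pow (?T \<times> ?T)"
    by (intro relations_subset_Pow) (auto simp: cartesian_power_def)
  moreover have "Id_on (diag m (points X)) \<subseteq> ?T \<times> ?T"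
    by (auto simp: diag_def tuples_def)
  ultimately have K: "?K \<subseteq> Pow (?T \<times> ?T)" by simp
  \<comment> \<open>The condition on fibers becomes membership of a fixed relation only when
    \<open>Y\<close> is coherent; this is why \<open>smallest_config\<close> asks for the
    equivalence on coherent configurations.\<close>
  have P: "?P Y \<longleftrightarrow> points Y = ?T \<and> ?K \<subseteq> relations Y" if "coherent_config Y" for Y
    unfolding union_of_fibers_iff[OF that] config_le_def by (auto simp: cartesian_power_def)
  note * = smallest_config(1,2)[OF finite_tuples[OF fin] K P]
  show coh: "coherent_config (m_extension m X)"
    unfolding m_extension_def by (rule *(1))
  show "cartesian_power m X \<sqsubseteq>\<^sub>c m_extension m X"
    unfolding m_extension_def using *(2) by blast
  show "Id_on (diag m (points X)) \<in> relations (m_extension m X)"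
    unfolding union_of_fibers_iff[OF coh, symmetric] unfolding m_extension_def using *(2) by blast
qed

text \<open>The relations invariant under \<open>h\<close> form a coherent configuration above
  \<open>X\<close> that fixes the points of \<open>A\<close>, so all relations of the point
  extension are invariant. The singleton at a point moved by \<open>h\<close> is not, so the
  extension is not complete.\<close>

lemma not_is_base_invariant:
  assumes fin: "finite (points X)" and sub: "\<Union>(basis X) \<subseteq> points X \<times> points X"
    and h: "bij_betw h (points X) (points X)"
    and inv: "\<And>s x y. \<lbrakk>s \<in> basis X; x \<in> points X; y \<in> points X\<rbrakk> \<Longrightarrow> (h x, h y) \<in> s \<longleftrightarrow> (x, y) \<in> s"
    and A: "\<And>\<alpha>. \<alpha> \<in> A \<Longrightarrow> h \<alpha> = \<alpha>" and \<delta>: "\<delta> \<in> points X" "h \<delta> \<noteq> \<delta>"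
  shows "\<not> is_base X A"
proof
  assume base: "is_base X A"
  then have AX: "A \<subseteq> points X" by (simp add: is_base_def)
  let ?O = "points X" and ?E = "point_extension X A"
  let ?R = "{r. r \<subseteq> ?O \<times> ?O \<and> (\<forall>x \<in> ?O. \<forall>y \<in> ?O. (h x, h y) \<in> r \<longleftrightarrow> (x, y) \<in> r)}"
  let ?Y = "algebra_config ?O ?R"
  note alg = coherent_algebra_invariant[OF h]
  have Y: "coherent_config ?Y" "relations ?Y = ?R"
    using coherent_algebra_config[OF alg fin] relations_algebra_config[OF alg fin] .
  have hO: "h x \<in> ?O" if "x \<in> ?O" for x using bij_betwE[OF h] that by blast
  have "relations X \<subseteq> ?R"
  proof
    fix r assume r: "r \<in> relations X"
    then obtain T where T: "T \<subseteq> basis X" "r = \<Union>T" by (auto simp: relations_def)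
    have "\<forall>x \<in> ?O. \<forall>y \<in> ?O. (h x, h y) \<in> r \<longleftrightarrow> (x, y) \<in> r"
      unfolding T(2) using inv T(1) by blast
    then show "r \<in> ?R" using relations_subset_Pow[OF sub] r by blast
  qed
  then have le_Y: "X \<sqsubseteq>\<^sub>c ?Y" unfolding config_le_def Y(2) by simp
  have fixed: "{(\<alpha>, \<alpha>)} \<in> relations ?Y" if "\<alpha> \<in> A" for \<alpha>
  proof -
    have "\<alpha> \<in> ?O" using AX that by blast
    then have "h x = \<alpha> \<longleftrightarrow> x = \<alpha>" if "x \<in> ?O" for x
      using inj_on_eq_iff[OF bij_betw_imp_inj_on[OF h] that] A[OF \<open>\<alpha> \<in> A\<close>] by metis
    then show ?thesis unfolding Y(2) using \<open>\<alpha> \<in> ?O\<close> by simp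
  qed
  have le: "?E \<sqsubseteq>\<^sub>c ?Y" by (rule point_extension_least[OF fin sub AX Y(1) le_Y fixed])
  have E: "coherent_config ?E" by (rule coherent_point_extension[OF fin sub AX])
  have pts: "points ?E = ?O" and sub_R: "relations ?E \<subseteq> ?R"
    using le unfolding config_le_def Y(2) by simp_all
  let ?s = "cell (basis ?E) (\<delta>, \<delta>)"
  have s: "?s \<in> basis ?E" "(\<delta>, \<delta>) \<in> ?s"
    using cell_mem[OF coherent_partition[OF E]] pts \<delta>(1) by auto
  have "complete_config ?E" using base by (simp add: is_base_def)
  then have "is_singleton ?s" using s(1) by (simp only: complete_config_def)
  then have s_eq: "?s = {(\<delta>, \<delta>)}" using s(2) unfolding is_singleton_def by (metis singletonD)
  have "{(\<delta>, \<delta>)} \<in> ?R"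
    using subsetD[OF sub_R basis_subset_relations[OF s(1)]] unfolding s_eq .
  then have "(h \<delta>, h \<delta>) \<in> {(\<delta>, \<delta>)} \<longleftrightarrow> (\<delta>, \<delta>) \<in> {(\<delta>, \<delta>)}" using \<delta>(1) by blast
  then show False using \<delta>(2) by simp
qed

section \<open>Determination of points\<close>

text \<open>In terms of valencies: the basis relation of \<open>(p, q)\<close> has valency one at
  \<open>p\<close>.\<close>

definition determines :: "'a config \<Rightarrow> 'a \<Rightarrow> 'a \<Rightarrow> bool" where
  "determines Y p q \<longleftrightarrow> (\<forall>q'. (p, q') \<in> cell (basis Y) (p, q) \<longrightarrow> q' = q)"

text \<open>A copy of the path through \<open>q\<close> that starts at \<open>p\<close> must pass
  through \<open>q\<close> again, and then ends in \<open>r\<close>.\<close>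

lemma determines_trans:
  assumes Y: "coherent_config Y" and "p \<in> points Y" "q \<in> points Y" "r \<in> points Y"
    and "determines Y p q" and "determines Y q r"
  shows "determines Y p r"
  unfolding determines_def
proof (intro allI impI)
  fix r' assume r': "(p, r') \<in> cell (basis Y) (p, r)"
  note c = cell_mem[OF coherent_partition[OF Y], of "(p, r)"]
  obtain z where "(p, z) \<in> cell (basis Y) (p, q)" "(z, r') \<in> cell (basis Y) (q, r)"
    by (rule coherent_path[OF Y c(1) c(2) r', of q]) (use assms in auto)
  then show "r' = r" using assms unfolding determines_def by blast
qed

text \<open>Since \<open>p\<close> determines \<open>a\<close>, every copy from \<open>p\<close> of
  the path through \<open>a\<close> passes through \<open>a\<close> itself. So a rival
  \<open>q'\<close> looks like \<open>q\<close> from both \<open>p\<close> and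
  \<open>a\<close>.\<close>

lemma determines_step:
  assumes Y: "coherent_config Y" and "p \<in> points Y" "a \<in> points Y" "q \<in> points Y"
    and "determines Y p a"
    and q: "\<And>q'. \<lbrakk>(a, q') \<in> cell (basis Y) (a, q); (p, q') \<in> cell (basis Y) (p, q)\<rbrakk> \<Longrightarrow> q' = q"
  shows "determines Y p q"
  unfolding determines_def
proof (intro allI impI)
  fix q' assume q': "(p, q') \<in> cell (basis Y) (p, q)"
  note c = cell_mem[OF coherent_partition[OF Y], of "(p, q)"]
  obtain z where "(p, z) \<in> cell (basis Y) (p, a)" "(z, q') \<in> cell (basis Y) (a, q)"
    by (rule coherent_path[OF Y c(1) c(2) q', of a]) (use assms in auto)
  then show "q' = q" using assms(5) q q' unfolding determines_def by blast
qed

text \<open>A certificate that speaks of the basis relations of \<open>X\<close> alone, so that it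
  can be read both in a point extension and in the 2-extension. In \<open>step\<close> the point is
  pinned by its relations to \<alpha> and \<beta>; \<open>trans\<close> chains such steps with
  \<alpha> kept fixed.\<close>

inductive linked :: "'a config \<Rightarrow> 'a \<Rightarrow> 'a \<Rightarrow> 'a \<Rightarrow> bool" for X \<alpha> where
  step: "\<lbrakk>\<beta> \<in> points X; \<gamma> \<in> points X;
    \<And>\<gamma>'. \<lbrakk>(\<alpha>, \<gamma>') \<in> cell (basis X) (\<alpha>, \<gamma>); (\<beta>, \<gamma>') \<in> cell (basis X) (\<beta>, \<gamma>)\<rbrakk> \<Longrightarrow> \<gamma>' = \<gamma>\<rbrakk>
    \<Longrightarrow> linked X \<alpha> \<beta> \<gamma>"
| trans: "\<lbrakk>linked X \<alpha> \<beta> \<gamma>; linked X \<alpha> \<gamma> \<delta>\<rbrakk> \<Longrightarrow> linked X \<alpha> \<beta> \<delta>"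

lemma linked_points: "linked X \<alpha> \<beta> \<gamma> \<Longrightarrow> \<beta> \<in> points X \<and> \<gamma> \<in> points X"
  by (induction rule: linked.induct) auto

text \<open>The map \<open>j\<close> is the identity for a point extension and \<open>\<gamma> \<mapsto> [\<alpha>, \<gamma>]\<close> for the 2-extension.\<close>

lemma linked_determines:
  assumes Y: "coherent_config Y" and j: "j ` points X \<subseteq> points Y" "inj j" and \<alpha>: "\<alpha> \<in> points X"
    and cells: "\<And>x y q'. \<lbrakk>x \<in> points X; y \<in> points X; (j x, q') \<in> cell (basis Y) (j x, j y)\<rbrakk>
      \<Longrightarrow> \<exists>y'. q' = j y' \<and> (x, y') \<in> cell (basis X) (x, y)"
    and det: "\<And>x. x \<in> points X \<Longrightarrow> determines Y (j x) (j \<alpha>)"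
    and "linked X \<alpha> \<beta> \<gamma>"
  shows "determines Y (j \<beta>) (j \<gamma>)"
  using assms(7)
proof (induction rule: linked.induct)
  case (step \<beta> \<gamma>)
  show ?case
  proof (rule determines_step[OF Y])
    show "j \<beta> \<in> points Y" "j \<alpha> \<in> points Y" "j \<gamma> \<in> points Y" using j \<alpha> step.hyps by auto
    show "determines Y (j \<beta>) (j \<alpha>)" by (rule det) fact
    fix q' assume q': "(j \<alpha>, q') \<in> cell (basis Y) (j \<alpha>, j \<gamma>)" "(j \<beta>, q') \<in> cell (basis Y) (j \<beta>, j \<gamma>)"
    obtain y where y: "q' = j y" "(\<alpha>, y) \<in> cell (basis X) (\<alpha>, \<gamma>)"
      using cells[OF \<alpha> step.hyps(2) q'(1)] by blast
    obtain z where z: "q' = j z" "(\<beta>, z) \<in> cell (basis X) (\<beta>, \<gamma>)"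
      using cells[OF step.hyps(1,2) q'(2)] by blast
    have "y = z" using injD[OF j(2)] y(1) z(1) by metis
    then show "q' = j \<gamma>" using step.hyps(3)[of y] y z by simp
  qed
next
  case (trans \<beta> \<gamma> \<delta>)
  have "j \<beta> \<in> points Y" "j \<gamma> \<in> points Y" "j \<delta> \<in> points Y"
    using linked_points[OF trans.hyps(1)] linked_points[OF trans.hyps(2)] j(1) by auto
  then show ?case by (rule determines_trans[OF Y _ _ _ trans.IH])
qed

text \<open>The point \<beta> is fixed and determines every point, so each fiber of the extension
  has one point, and a basis relation between two such fibers is a singleton.\<close>

lemma is_base_linked:
  assumes fin: "finite (points X)" and part: "partition_on (points X \<times> points X) (basis X)"
    and \<alpha>: "\<alpha> \<in> points X" and \<beta>: "\<beta> \<in> points X"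
    and linked: "\<And>\<gamma>. \<gamma> \<in> points X \<Longrightarrow> linked X \<alpha> \<beta> \<gamma>"
  shows "is_base X {\<alpha>, \<beta>}"
proof -
  let ?Y = "point_extension X {\<alpha>, \<beta>}"
  have sub: "\<Union>(basis X) \<subseteq> points X \<times> points X" using partition_onD1[OF part] by simp
  have A: "{\<alpha>, \<beta>} \<subseteq> points X" using \<alpha> \<beta> by simp
  note Y = coherent_point_extension[OF fin sub A]
  have le: "X \<sqsubseteq>\<^sub>c ?Y" by (rule le_point_extension[OF fin sub A])
  then have pts: "points ?Y = points X" by (simp add: config_le_def)
  have fixed: "cell (basis ?Y) (x, x) \<subseteq> {(x, x)}" if "x \<in> {\<alpha>, \<beta>}" for x
    by (rule cell_subset_relation[OF Y point_extension_fixes[OF fin sub A that]]) simp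
  have cells: "cell (basis ?Y) p \<subseteq> cell (basis X) p" if "p \<in> points X \<times> points X" for p
    by (rule cell_subset_relation[OF Y])
      (use cell_mem[OF part that] basis_subset_relations[of _ X] le in \<open>auto simp: config_le_def\<close>)
  have det: "determines ?Y \<beta> \<gamma>" if "\<gamma> \<in> points X" for \<gamma>
  proof (rule linked_determines[of ?Y "\<lambda>x. x", OF Y _ _ \<alpha> _ _ linked[OF that]])
    show "(\<lambda>x. x) ` points X \<subseteq> points ?Y" using pts by simp
    show "inj (\<lambda>x. x)" by (rule inj_on_id2)
    show "\<exists>y'. q' = y' \<and> (x, y') \<in> cell (basis X) (x, y)"
      if "x \<in> points X" "y \<in> points X" "(x, q') \<in> cell (basis ?Y) (x, y)" for x y q'
      using cells[of "(x, y)"] that by auto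
    show "determines ?Y x \<alpha>" if "x \<in> points X" for x
      unfolding determines_def
    proof (intro allI impI)
      fix q' assume "(x, q') \<in> cell (basis ?Y) (x, \<alpha>)"
      then have "(q', q') \<in> cell (basis ?Y) (\<alpha>, \<alpha>)"
        by (rule cell_target[OF Y, rotated 2]) (use that \<alpha> pts in auto)
      then show "q' = \<alpha>" using fixed[of \<alpha>] by auto
    qed
  qed
  have "cell (basis ?Y) (\<gamma>, \<gamma>) \<subseteq> {(\<gamma>, \<gamma>)}" if \<gamma>: "\<gamma> \<in> points X" for \<gamma>
  proof
    fix p assume p: "p \<in> cell (basis ?Y) (\<gamma>, \<gamma>)"
    then obtain \<gamma>' where p\<gamma>: "p = (\<gamma>', \<gamma>')" using cell_diagonal[OF Y] \<gamma> pts by auto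
    note c = cell_mem[OF coherent_partition[OF Y], of "(\<gamma>, \<gamma>)"]
    \<comment> \<open>The loop at \<gamma> through \<beta> is copied to a loop at
      \<open>\<gamma>'\<close>. Its middle point is again \<beta>, which is fixed, and \<beta>
      determines \<gamma>.\<close>
    obtain z where z: "(\<gamma>', z) \<in> cell (basis ?Y) (\<gamma>, \<beta>)" "(z, \<gamma>') \<in> cell (basis ?Y) (\<beta>, \<gamma>)"
      by (rule coherent_path[OF Y c(1) c(2), of \<gamma>' \<gamma>' \<beta>]) (use p p\<gamma> \<gamma> \<beta> pts in auto)
    have "(z, z) \<in> cell (basis ?Y) (\<beta>, \<beta>)" by (rule cell_target[OF Y _ _ z(1)]) (use \<gamma> \<beta> pts in auto)
    then have "z = \<beta>" using fixed[of \<beta>] by auto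
    then show "p \<in> {(\<gamma>, \<gamma>)}" using det[OF \<gamma>] z(2) p\<gamma> unfolding determines_def by simp
  qed
  then have single: "x' = x" if "(x', x') \<in> cell (basis ?Y) (x, x)" "x \<in> points X" for x x'
    using that by blast
  have "is_singleton s" if s: "s \<in> basis ?Y" for s
  proof -
    have "s \<noteq> {}" using partition_onD3[OF coherent_partition[OF Y]] s by metis
    then obtain x y where xy: "(x, y) \<in> s" by auto
    then have pt: "x \<in> points ?Y" "y \<in> points ?Y" using basis_subset[OF Y s] by auto
    have sc: "s = cell (basis ?Y) (x, y)"
      using cell_eq[OF coherent_partition[OF Y] s xy] by simp
    have "p = (x, y)" if "p \<in> s" for p
      using single cell_source[OF Y pt] cell_target[OF Y pt] that sc pt pts
      by (metis surj_pair)
    then have "s = {(x, y)}" using xy by blast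
    then show ?thesis by (simp add: is_singleton_def)
  qed
  then show ?thesis using A by (simp add: is_base_def complete_config_def)
qed

section \<open>Algebraic isomorphisms\<close>

lemma algebraic_iso_intersection_number:
  assumes "algebraic_iso Y Y' \<psi>" and "r \<in> basis Y" "s \<in> basis Y" "t \<in> basis Y"
  shows "intersection_number (\<psi> r) (\<psi> s) (\<psi> t) = intersection_number r s t"
  using assms by (simp add: algebraic_iso_def)

lemma algebraic_iso_basis:
  assumes "algebraic_iso Y Y' \<psi>"
  shows "\<psi> ` basis Y = basis Y'"
  using assms by (simp add: algebraic_iso_def bij_betw_def)

text \<open>The diagonal relation at a target of \<open>\<psi> e\<close> acts on
  \<open>\<psi> e\<close> as a right unit. Its preimage \<open>d0\<close> then has a nonzero
  intersection number with \<open>e\<close> and \<open>e\<close>; as \<open>e\<close> is diagonal,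
  \<open>d0\<close> meets \<open>e\<close> and equals it.\<close>

lemma algebraic_iso_Id:
  assumes part: "partition_on A (basis Y)" and Y': "coherent_config Y'"
    and iso: "algebraic_iso Y Y' \<psi>" and e: "e \<in> basis Y" "e \<subseteq> Id"
  shows "\<psi> e \<subseteq> Id"
proof
  fix p assume "p \<in> \<psi> e"
  then obtain x y where p: "p = (x, y)" and xy: "(x, y) \<in> \<psi> e" by (cases p) auto
  have \<psi>e: "\<psi> e \<in> basis Y'" using algebraic_iso_basis[OF iso] e by auto
  then have y: "y \<in> points Y'" using basis_subset[OF Y'] xy by blast
  let ?d = "cell (basis Y') (y, y)"
  have d: "?d \<in> basis Y'" "(y, y) \<in> ?d" using cell_mem[OF coherent_partition[OF Y']] y by auto
  then obtain d0 where d0: "d0 \<in> basis Y" "?d = \<psi> d0"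
    using algebraic_iso_basis[OF iso] by (metis imageE)
  have "intersection_number (\<psi> e) ?d (\<psi> e) \<noteq> 0"
    using intersection_number_pos[OF Y' \<psi>e d(1) \<psi>e xy] xy d(2) by blast
  then have ne: "intersection_number e d0 e \<noteq> 0"
    using algebraic_iso_intersection_number[OF iso e(1) d0(1) e(1)] d0(2) by simp
  have "d0 = e"
  proof (rule ccontr)
    assume "d0 \<noteq> e"
    then have disj: "d0 \<inter> e = {}" using part d0(1) e(1) unfolding partition_on_def disjoint_def by blast
    have "intersection_number e d0 e = 0"
    proof (rule intersection_number_eqI)
      show "card (e `` {x} \<inter> d0\<inverse> `` {y}) = 0" if "(x, y) \<in> e" for x y
      proof -
        have "e `` {x} \<inter> d0\<inverse> `` {y} = {}" using that e(2) disj by blast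
        then show ?thesis by simp
      qed
      show "e \<noteq> {}" using part e(1) unfolding partition_on_def by metis
    qed
    then show False using ne by simp
  qed
  then show "p \<in> Id" using xy d0(2) cell_diagonal[OF Y' y] p by auto
qed

lemma coherent_converse: "\<lbrakk>coherent_config Y; s \<in> basis Y\<rbrakk> \<Longrightarrow> s\<inverse> \<in> basis Y"
  by (simp add: coherent_config_def)

text \<open>Going along \<open>s\<close> and back gives a nonzero number at a diagonal relation. Its
  image is diagonal too, so there is a closed path with legs in \<open>\<psi> s\<close> and in the
  image of the converse of \<open>s\<close>, and two basis relations that meet are equal.\<close>

lemma algebraic_iso_converse:
  assumes Y: "coherent_config Y" and Y': "coherent_config Y'"
    and iso: "algebraic_iso Y Y' \<psi>" and s: "s \<in> basis Y"
  shows "\<psi> (s\<inverse>) = (\<psi> s)\<inverse>"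
proof -
  have "s \<noteq> {}" using partition_onD3[OF coherent_partition[OF Y]] s by metis
  then obtain x y where xy: "(x, y) \<in> s" by auto
  then have x: "x \<in> points Y" using basis_subset[OF Y s] by blast
  let ?e = "cell (basis Y) (x, x)"
  have e: "?e \<in> basis Y" "(x, x) \<in> ?e" using cell_mem[OF coherent_partition[OF Y]] x by auto
  note s' = coherent_converse[OF Y s]
  have im: "\<psi> r \<in> basis Y'" if "r \<in> basis Y" for r using algebraic_iso_basis[OF iso] that by auto
  have "intersection_number s (s\<inverse>) ?e \<noteq> 0"
    using intersection_number_pos[OF Y s s' e] xy by blast
  then have ne: "intersection_number (\<psi> s) (\<psi> (s\<inverse>)) (\<psi> ?e) \<noteq> 0"
    using algebraic_iso_intersection_number[OF iso s s' e(1)] by simp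
  have "\<psi> ?e \<noteq> {}" using partition_onD3[OF coherent_partition[OF Y']] im[OF e(1)] by metis
  then obtain x' where x': "(x', x') \<in> \<psi> ?e"
    using algebraic_iso_Id[OF coherent_partition[OF Y] Y' iso e(1) cell_diagonal[OF Y x]] by auto
  obtain z where z: "(x', z) \<in> \<psi> s" "(z, x') \<in> \<psi> (s\<inverse>)"
    using intersection_number_pos[OF Y' im[OF s] im[OF s'] im[OF e(1)] x'] ne by blast
  then have "(z, x') \<in> (\<psi> s)\<inverse>" by simp
  then show ?thesis
    using cell_eq[OF coherent_partition[OF Y'] im[OF s'] z(2)]
      cell_eq[OF coherent_partition[OF Y'] coherent_converse[OF Y' im[OF s]]] by metis
qed

text \<open>A valency is the intersection number of a relation and its converse at a diagonal
  relation.\<close>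

lemma algebraic_iso_valency:
  assumes Y: "coherent_config Y" and Y': "coherent_config Y'"
    and iso: "algebraic_iso Y Y' \<psi>" and s: "s \<in> basis Y"
    and e: "e \<in> basis Y" "(p, p) \<in> e" "(p', p') \<in> \<psi> e"
  shows "card (\<psi> s `` {p'}) = card (s `` {p})"
proof -
  note s' = coherent_converse[OF Y s]
  have im: "\<psi> r \<in> basis Y'" if "r \<in> basis Y" for r using algebraic_iso_basis[OF iso] that by auto
  have "card (s `` {p}) = intersection_number s (s\<inverse>) e"
    using intersection_number_eq[OF Y s s' e(1,2)] by simp
  also have "\<dots> = intersection_number (\<psi> s) (\<psi> (s\<inverse>)) (\<psi> e)"
    using algebraic_iso_intersection_number[OF iso s s' e(1)] by simp
  also have "\<dots> = card (\<psi> s `` {p'})"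
    using intersection_number_eq[OF Y' im[OF s] im[OF s'] im[OF e(1)] e(3)]
      algebraic_iso_converse[OF Y Y' iso s] by simp
  finally show ?thesis by simp
qed

section \<open>Separability\<close>

lemma tuple_rel_pair_iff:
  "([x1, x2], [y1, y2]) \<in> tuple_rel [s1, s2] \<longleftrightarrow> (x1, y1) \<in> s1 \<and> (x2, y2) \<in> s2"
  by (auto simp: tuple_rel_def less_Suc_eq)

lemma tuple_rel_pairE:
  assumes "(xs, ys) \<in> tuple_rel [s1, s2]"
  obtains x1 x2 y1 y2 where "xs = [x1, x2]" "ys = [y1, y2]" "(x1, y1) \<in> s1" "(x2, y2) \<in> s2"
proof -
  have "length xs = 2" "length ys = 2" using assms by (auto simp: tuple_rel_def)
  then obtain x1 x2 y1 y2 where eq: "xs = [x1, x2]" "ys = [y1, y2]"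
    by (auto simp: numeral_2_eq_2 length_Suc_conv)
  show ?thesis
    by (rule that[OF eq]) (use assms in \<open>auto simp: eq tuple_rel_pair_iff\<close>)
qed

text \<open>The point \<open>[\<alpha>, \<beta>]\<close> determines every
  \<open>[\<alpha>, \<gamma>]\<close> in the 2-extension. After choosing an image \<open>p'\<close>
  of \<open>[\<alpha>, \<beta>]\<close>, the map \<open>\<psi>\<close> sends each of these basis
  relations of valency one to another one, whose end point at \<open>p'\<close> defines
  \<open>f \<gamma>\<close>.\<close>

lemma m_separable_linked:
  fixes X :: "'a config"
  assumes fin: "finite (points X)" and part: "partition_on (points X \<times> points X) (basis X)"
    and Id: "Id_on (points X) \<in> basis X"
    and \<alpha>: "\<alpha> \<in> points X" and \<beta>: "\<beta> \<in> points X"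
    and linked: "\<And>\<gamma>. \<gamma> \<in> points X \<Longrightarrow> linked X \<alpha> \<beta> \<gamma>"
  shows "m_separable TYPE('b) 2 X"
  unfolding m_separable_def
proof (intro allI impI, elim conjE)
  fix X' :: "'b config" and \<phi>
  assume X': "coherent_config X'" and iso: "algebraic_iso X X' \<phi>" and dim: "m_dimensional 2 X X' \<phi>"
  let ?Y = "m_extension 2 X" and ?Y' = "m_extension 2 X'" and ?e = "Id_on (points X)"
  let ?c = "cell (basis X)" and ?cY = "cell (basis ?Y)"
  have sub: "\<Union>(basis X) \<subseteq> points X \<times> points X" using partition_onD1[OF part] by simp
  have sub': "\<Union>(basis X') \<subseteq> points X' \<times> points X'"
    using partition_onD1[OF coherent_partition[OF X']] by simp
  note Y = coherent_m_extension[OF fin sub, of 2]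
  note Y' = coherent_m_extension[OF coherent_finite[OF X'] sub', of 2]
  note partY = coherent_partition[OF Y] and partY' = coherent_partition[OF Y']
  have leY: "points ?Y = tuples 2 (points X)"
      "relations (cartesian_power 2 X) \<subseteq> relations ?Y"
    using le_m_extension[OF fin sub, of 2] by (auto simp: config_le_def cartesian_power_def)
  have ptsY': "points ?Y' = tuples 2 (points X')"
    using le_m_extension[OF coherent_finite[OF X'] sub', of 2]
    by (auto simp: config_le_def cartesian_power_def)
  have pairY: "[x, y] \<in> points ?Y" if "x \<in> points X" "y \<in> points X" for x y
    using that leY(1) by (simp add: tuples_def)
  obtain \<psi> where \<psi>: "algebraic_iso ?Y ?Y' \<psi>"
      and ext: "\<And>ss. ss \<in> tuples 2 (basis X) \<Longrightarrow>
        rel_ext ?Y \<psi> (tuple_rel ss) = tuple_rel (map \<phi> ss)"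
    using dim unfolding m_dimensional_def by blast
  have ext2: "\<Union>(\<psi> ` {t \<in> basis ?Y. t \<subseteq> tuple_rel [s1, s2]}) = tuple_rel [\<phi> s1, \<phi> s2]"
    if "s1 \<in> basis X" "s2 \<in> basis X" for s1 s2
    using ext[of "[s1, s2]"] that by (simp add: tuples_def rel_ext_def)
  have im: "\<psi> t \<in> basis ?Y'" if "t \<in> basis ?Y" for t using algebraic_iso_basis[OF \<psi>] that by auto
  have img: "\<psi> t \<subseteq> tuple_rel [\<phi> s1, \<phi> s2]"
    if "s1 \<in> basis X" "s2 \<in> basis X" "t \<in> basis ?Y" "t \<subseteq> tuple_rel [s1, s2]" for s1 s2 t
    using ext2[OF that(1,2)] that(3,4) by blast
  have tuple_relation: "tuple_rel [s1, s2] \<in> relations ?Y"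
    if "s1 \<in> basis X" "s2 \<in> basis X" for s1 s2
  proof -
    have "tuple_rel [s1, s2] \<in> basis (cartesian_power 2 X)"
      using that by (simp add: cartesian_power_def tuples_def)
    then show ?thesis using basis_subset_relations leY(2) by blast
  qed
  have c: "?c p \<in> basis X" "p \<in> ?c p" if "p \<in> points X \<times> points X" for p
    using cell_mem[OF part that] .
  have cellY: "?cY ([\<alpha>, x], [\<alpha>, y]) \<in> basis ?Y" "([\<alpha>, x], [\<alpha>, y]) \<in> ?cY ([\<alpha>, x], [\<alpha>, y])"
    if "x \<in> points X" "y \<in> points X" for x y
    using cell_mem[OF partY, of "([\<alpha>, x], [\<alpha>, y])"] pairY \<alpha> that by auto
  \<comment> \<open>The first factor is the diagonal, so every point in this relation to
    \<open>[\<alpha>, x]\<close> has first coordinate \<alpha> again.\<close>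
  have cell_tuple: "?cY ([\<alpha>, x], [\<alpha>, y]) \<subseteq> tuple_rel [?e, ?c (x, y)]"
    if "x \<in> points X" "y \<in> points X" for x y
    by (rule cell_subset_relation[OF Y tuple_relation[OF Id c(1)]])
      (use that \<alpha> c(2)[of "(x, y)"] in \<open>auto simp: tuple_rel_pair_iff Id_on_iff\<close>)
  have cell_pair: "\<exists>y'. q' = [\<alpha>, y'] \<and> (x, y') \<in> ?c (x, y)"
    if xy: "x \<in> points X" "y \<in> points X" and q': "([\<alpha>, x], q') \<in> ?cY ([\<alpha>, x], [\<alpha>, y])" for x y q'
  proof -
    have "([\<alpha>, x], q') \<in> tuple_rel [?e, ?c (x, y)]" using cell_tuple[OF xy] q' by blast
    then show ?thesis by (rule tuple_rel_pairE) (auto simp: Id_on_iff)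
  qed
  \<comment> \<open>The diagonal is a relation of the 2-extension and
    \<open>[\<alpha>, \<alpha>]\<close> is its only point with first coordinate \<alpha>; it stands
    in for the fixed point \<alpha> of a point extension.\<close>
  have det\<alpha>: "determines ?Y [\<alpha>, x] [\<alpha>, \<alpha>]" if x: "x \<in> points X" for x
    unfolding determines_def
  proof (intro allI impI)
    fix q' assume q': "([\<alpha>, x], q') \<in> ?cY ([\<alpha>, x], [\<alpha>, \<alpha>])"
    then obtain y where y: "q' = [\<alpha>, y]" using cell_pair[OF x \<alpha>] by blast
    have "(q', q') \<in> ?cY ([\<alpha>, \<alpha>], [\<alpha>, \<alpha>])"
      by (rule cell_target[OF Y pairY[OF \<alpha> x] pairY[OF \<alpha> \<alpha>] q'])
    moreover have "?cY ([\<alpha>, \<alpha>], [\<alpha>, \<alpha>]) \<subseteq> Id_on (diag 2 (points X))"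
      by (rule cell_subset_relation[OF Y m_extension_diag[OF fin sub]])
        (use \<alpha> in \<open>auto simp: diag_def numeral_2_eq_2\<close>)
    ultimately have "q' \<in> diag 2 (points X)" by auto
    then show "q' = [\<alpha>, \<alpha>]" using y by (auto simp: diag_def numeral_2_eq_2)
  qed
  have det: "determines ?Y [\<alpha>, \<beta>] [\<alpha>, \<gamma>]" if \<gamma>: "\<gamma> \<in> points X" for \<gamma>
  proof (rule linked_determines[of ?Y "\<lambda>x. [\<alpha>, x]", OF Y _ _ \<alpha> cell_pair det\<alpha> linked[OF \<gamma>]])
    show "(\<lambda>x. [\<alpha>, x]) ` points X \<subseteq> points ?Y" using pairY \<alpha> by blast
    show "inj (\<lambda>x. [\<alpha>, x])" by (rule injI) simp
  qed

  let ?p = "[\<alpha>, \<beta>]"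
  let ?u = "\<lambda>\<gamma>. ?cY (?p, [\<alpha>, \<gamma>])"
  have \<psi>_Id: "\<psi> (?u \<beta>) \<subseteq> Id"
    by (rule algebraic_iso_Id[OF partY Y' \<psi> cellY(1)[OF \<beta> \<beta>] cell_diagonal[OF Y pairY[OF \<alpha> \<beta>]]])
  have "\<psi> (?u \<beta>) \<noteq> {}" using partition_onD3[OF partY'] im[OF cellY(1)[OF \<beta> \<beta>]] by metis
  \<comment> \<open>Any point of the fiber corresponding to that of
    \<open>[\<alpha>, \<beta>]\<close> will do.\<close>
  then obtain p' where p': "(p', p') \<in> \<psi> (?u \<beta>)" using \<psi>_Id by auto
  have \<phi>e: "\<phi> ?e \<subseteq> Id"
    by (rule algebraic_iso_Id[OF part X' iso Id]) auto
  have img_cell: "\<psi> (?cY ([\<alpha>, x], [\<alpha>, y])) \<subseteq> tuple_rel [\<phi> ?e, \<phi> (?c (x, y))]"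
    if "x \<in> points X" "y \<in> points X" for x y
    by (rule img[OF Id c(1) cellY(1) cell_tuple]) (use that in auto)
  obtain a' b' where ab: "p' = [a', b']" "(a', a') \<in> \<phi> ?e"
  proof -
    have "(p', p') \<in> tuple_rel [\<phi> ?e, \<phi> (?c (\<beta>, \<beta>))]" using img_cell[OF \<beta> \<beta>] p' by blast
    then show ?thesis by (rule tuple_rel_pairE) (use that in auto)
  qed
  have b': "b' \<in> points X'"
    using basis_subset[OF Y' im[OF cellY(1)[OF \<beta> \<beta>]]] p' ab(1) ptsY' by (auto simp: tuples_def)

  have "\<exists>x. \<psi> (?u \<gamma>) `` {p'} = {[a', x]}" if \<gamma>: "\<gamma> \<in> points X" for \<gamma>
  proof -
    \<comment> \<open>Determination says that this valency is one, and valencies are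
      preserved.\<close>
    have "?u \<gamma> `` {?p} = {[\<alpha>, \<gamma>]}"
      using det[OF \<gamma>] cellY(2)[OF \<beta> \<gamma>] unfolding determines_def by blast
    then have "card (\<psi> (?u \<gamma>) `` {p'}) = 1"
      using algebraic_iso_valency[OF Y Y' \<psi> cellY(1)[OF \<beta> \<gamma>] cellY(1,2)[OF \<beta> \<beta>] p'] by simp
    then obtain q' where q': "\<psi> (?u \<gamma>) `` {p'} = {q'}" by (auto simp: card_1_singleton_iff)
    then have "(p', q') \<in> \<psi> (?u \<gamma>)" by auto
    then have "(p', q') \<in> tuple_rel [\<phi> ?e, \<phi> (?c (\<beta>, \<gamma>))]" using img_cell[OF \<beta> \<gamma>] by blast
    then obtain x1 x2 y1 y2 where "p' = [x1, x2]" "q' = [y1, y2]" "(x1, y1) \<in> \<phi> ?e"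
      by (rule tuple_rel_pairE)
    then have "q' = [a', y2]" using ab(1) \<phi>e by auto
    then show ?thesis using q' by blast
  qed
  then obtain f where f: "\<And>\<gamma>. \<gamma> \<in> points X \<Longrightarrow> \<psi> (?u \<gamma>) `` {p'} = {[a', f \<gamma>]}" by metis

  \<comment> \<open>The path from \<open>[\<alpha>, \<beta>]\<close> over
    \<open>[\<alpha>, \<gamma>]\<close> to \<open>[\<alpha>, \<delta>]\<close> is transported to one
    from \<open>p'\<close>, whose inner point and end are forced. The second coordinates of its last
    leg give the claim.\<close>
  have f_hom: "(f \<gamma>, f \<delta>) \<in> \<phi> (?c (\<gamma>, \<delta>))" if \<gamma>: "\<gamma> \<in> points X" and \<delta>: "\<delta> \<in> points X" for \<gamma> \<delta>
  proof -
    let ?v = "?cY ([\<alpha>, \<gamma>], [\<alpha>, \<delta>])"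
    note u\<gamma> = cellY[OF \<beta> \<gamma>] and u\<delta> = cellY[OF \<beta> \<delta>] and v = cellY[OF \<gamma> \<delta>]
    have "intersection_number (?u \<gamma>) ?v (?u \<delta>) \<noteq> 0"
      using intersection_number_pos[OF Y u\<gamma>(1) v(1) u\<delta>(1) u\<delta>(2)] u\<gamma>(2) v(2) by blast
    then have ne: "intersection_number (\<psi> (?u \<gamma>)) (\<psi> ?v) (\<psi> (?u \<delta>)) \<noteq> 0"
      using algebraic_iso_intersection_number[OF \<psi> u\<gamma>(1) v(1) u\<delta>(1)] by simp
    have "(p', [a', f \<delta>]) \<in> \<psi> (?u \<delta>)" using f[OF \<delta>] by auto
    then obtain z where z: "(p', z) \<in> \<psi> (?u \<gamma>)" "(z, [a', f \<delta>]) \<in> \<psi> ?v"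
      using intersection_number_pos[OF Y' im[OF u\<gamma>(1)] im[OF v(1)] im[OF u\<delta>(1)]] ne by blast
    then have "z = [a', f \<gamma>]" using f[OF \<gamma>] by auto
    then show ?thesis using z(2) img_cell[OF \<gamma> \<delta>] by (auto simp: tuple_rel_pair_iff)
  qed

  have \<phi>B: "\<phi> s \<in> basis X'" if "s \<in> basis X" for s using algebraic_iso_basis[OF iso] that by auto
  have \<phi>_inj: "s = t" if "s \<in> basis X" "t \<in> basis X" "\<phi> s = \<phi> t" for s t
    using iso that by (auto simp: algebraic_iso_def bij_betw_def inj_on_eq_iff)
  have c_eq: "?c p = s" if "s \<in> basis X" "p \<in> s" for s p using cell_eq[OF part that] .
  \<comment> \<open>Images under \<open>f\<close> also reflect basis relations: the relation
    containing \<open>(f \<gamma>, f \<delta>)\<close> is unique, and \<open>\<phi>\<close> is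
    injective.\<close>
  have hom_eq: "?c (\<gamma>, \<delta>) = s"
    if "\<gamma> \<in> points X" "\<delta> \<in> points X" "s \<in> basis X" "(f \<gamma>, f \<delta>) \<in> \<phi> s" for \<gamma> \<delta> s
  proof -
    note part' = coherent_partition[OF X']
    have "\<phi> (?c (\<gamma>, \<delta>)) = \<phi> s"
      using cell_eq[OF part' \<phi>B[OF that(3)] that(4)]
        cell_eq[OF part' \<phi>B[OF c(1)] f_hom[OF that(1,2)]] that(1,2) by auto
    then show ?thesis using \<phi>_inj c(1) that by auto
  qed
  have f_mem: "f \<gamma> \<in> points X'" if "\<gamma> \<in> points X" for \<gamma>
    using f_hom[OF that that] basis_subset[OF X' \<phi>B[OF c(1)]] that by blast
  have inj: "inj_on f (points X)"
  proof (rule inj_onI)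
    fix \<gamma> \<delta> assume \<gamma>: "\<gamma> \<in> points X" and \<delta>: "\<delta> \<in> points X" and eq: "f \<gamma> = f \<delta>"
    have "?c (\<gamma>, \<gamma>) = ?e" by (rule c_eq[OF Id]) (use \<gamma> in auto)
    then have "(f \<gamma>, f \<delta>) \<in> \<phi> ?e" using f_hom[OF \<gamma> \<gamma>] eq by simp
    then have "?c (\<gamma>, \<delta>) = ?e" by (rule hom_eq[OF \<gamma> \<delta> Id])
    then show "\<gamma> = \<delta>" using c(2)[of "(\<gamma>, \<delta>)"] \<gamma> \<delta> by auto
  qed
  \<comment> \<open>The pair of \<open>p'\<close> and \<open>[a', x']\<close> lies in the image of
    some basis relation \<open>t\<close> inside \<open>tuple_rel [?e, s]\<close>. As valencies
    agree, \<open>t\<close> also leaves \<open>[\<alpha>, \<beta>]\<close>, towards some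
    \<open>[\<alpha>, y2]\<close>; then \<open>x'\<close> can only be \<open>f y2\<close>.\<close>
  have surj: "\<exists>\<gamma> \<in> points X. f \<gamma> = x'" if x': "x' \<in> points X'" for x'
  proof -
    obtain s where s: "s \<in> basis X" "(b', x') \<in> \<phi> s"
      using cell_mem[OF coherent_partition[OF X'], of "(b', x')"] b' x' algebraic_iso_basis[OF iso]
      by (metis SigmaI imageE)
    then have "(p', [a', x']) \<in> tuple_rel [\<phi> ?e, \<phi> s]"
      using ab by (simp add: tuple_rel_pair_iff)
    then obtain t where t: "t \<in> basis ?Y" "t \<subseteq> tuple_rel [?e, s]" "(p', [a', x']) \<in> \<psi> t"
      using ext2[OF Id s(1)] by blast
    note e = cellY[OF \<beta> \<beta>]
    have "\<psi> t `` {p'} \<noteq> {}" using t(3) by blast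
    then have "card (t `` {?p}) \<noteq> 0"
      using algebraic_iso_valency[OF Y Y' \<psi> t(1) e p'] finite_basis_image[OF Y' im[OF t(1)]]
      by (metis card_eq_0_iff)
    then have "t `` {?p} \<noteq> {}" by (metis card.empty)
    then obtain q where q: "(?p, q) \<in> t" by blast
    then have "(?p, q) \<in> tuple_rel [?e, s]" using t(2) by blast
    then obtain x1 x2 y1 y2 where *: "?p = [x1, x2]" "q = [y1, y2]" "(x1, y1) \<in> ?e" "(x2, y2) \<in> s"
      by (rule tuple_rel_pairE)
    then have q_eq: "q = [\<alpha>, y2]" by auto
    have y2: "y2 \<in> points X" using * sub s(1) by blast
    have "?u y2 = t" using cell_eq[OF partY t(1) q] q_eq by simp
    then have "\<psi> t `` {p'} = {[a', f y2]}" using f[OF y2] by simp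
    moreover have "[a', x'] \<in> \<psi> t `` {p'}" using t(3) by simp
    ultimately have "[a', x'] \<in> {[a', f y2]}" by simp
    then show ?thesis using y2 by auto
  qed
  have bij: "bij_betw f (points X) (points X')"
    unfolding bij_betw_def using inj f_mem surj by blast
  have "{(f x, f y) | x y. (x, y) \<in> s} = \<phi> s" if s: "s \<in> basis X" for s
  proof -
    have sX: "x \<in> points X \<and> y \<in> points X" if "(x, y) \<in> s" for x y using that s sub by blast
    show ?thesis
    proof (rule subset_antisym; rule subrelI)
      fix x' y' assume "(x', y') \<in> {(f x, f y) | x y. (x, y) \<in> s}"
      then obtain x y where "(x, y) \<in> s" "x' = f x" "y' = f y" by blast
      then show "(x', y') \<in> \<phi> s" using f_hom sX c_eq[OF s] by metis
    next
      fix x' y' assume xy': "(x', y') \<in> \<phi> s"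
      then have "x' \<in> points X'" "y' \<in> points X'" using basis_subset[OF X' \<phi>B[OF s]] by blast+
      then obtain x y where xy: "x \<in> points X" "y \<in> points X" "f x = x'" "f y = y'"
        using surj by metis
      then have "?c (x, y) = s" using hom_eq[OF xy(1,2) s] xy' by simp
      then have "(x, y) \<in> s" using c(2)[of "(x, y)"] xy(1,2) by auto
      then show "(x', y') \<in> {(f x, f y) | x y. (x, y) \<in> s}" using xy(3,4) by blast
    qed
  qed
  then show "induced_by_iso X X' \<phi>" using bij unfolding induced_by_iso_def by blast
qed

section \<open>The Cartan scheme in terms of matrices\<close>

definition mat2 :: "'f::field \<Rightarrow> 'f \<Rightarrow> 'f \<Rightarrow> 'f \<Rightarrow> 'f ^ 2 ^ 2" where
  "mat2 a b c d = vector [vector [a, b], vector [c, d]]"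

lemma mat2_nth [simp]:
  "mat2 a b c d $ 1 $ 1 = a" "mat2 a b c d $ 1 $ 2 = b"
  "mat2 a b c d $ 2 $ 1 = c" "mat2 a b c d $ 2 $ 2 = d"
  by (simp_all add: mat2_def)

lemma matrix_eq_iff_2:
  fixes A B :: "'f::field ^ 2 ^ 2"
  shows "A = B \<longleftrightarrow> A $ 1 $ 1 = B $ 1 $ 1 \<and> A $ 1 $ 2 = B $ 1 $ 2 \<and>
    A $ 2 $ 1 = B $ 2 $ 1 \<and> A $ 2 $ 2 = B $ 2 $ 2"
  by (auto simp: vec_eq_iff forall_2)

lemma matrix_mult_nth_2:
  fixes A B :: "'f::field ^ 2 ^ 2"
  shows "(A ** B) $ i $ j = A $ i $ 1 * B $ 1 $ j + A $ i $ 2 * B $ 2 $ j"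
  by (simp add: matrix_matrix_mult_def sum_2)

lemma mat_nth_2: "(mat c :: 'f::field ^ 2 ^ 2) $ i $ j = (if i = j then c else 0)"
  by (simp add: mat_def)

section \<open>The group SL(2) with its diagonal and scalar subgroups\<close>

lemma carrier_SL2: "A \<in> carrier SL2 \<longleftrightarrow> det A = 1"
  by (simp add: SL2_def)

lemma mult_SL2 [simp]: "A \<otimes>\<^bsub>SL2\<^esub> B = A ** B"
  by (simp add: SL2_def)

lemma one_SL2 [simp]: "\<one>\<^bsub>SL2\<^esub> = mat 1"
  by (simp add: SL2_def)

lemma mult_closed_SL2: "A \<in> carrier SL2 \<Longrightarrow> B \<in> carrier SL2 \<Longrightarrow> A ** B \<in> carrier SL2"
  by (simp add: carrier_SL2 det_mul)

lemma mat_1_SL2: "mat 1 \<in> carrier SL2"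
  by (simp add: carrier_SL2)

text \<open>The adjugate, which inverts matrices of determinant one without any division.\<close>

definition adj2 :: "'f::field ^ 2 ^ 2 \<Rightarrow> 'f ^ 2 ^ 2" where
  "adj2 A = mat2 (A $ 2 $ 2) (- A $ 1 $ 2) (- A $ 2 $ 1) (A $ 1 $ 1)"

lemma adj2_mult: "A \<in> carrier SL2 \<Longrightarrow> adj2 A ** A = mat 1"
  by (simp add: carrier_SL2 adj2_def matrix_eq_iff_2 matrix_mult_nth_2 mat_nth_2 det_2 algebra_simps)

lemma adj2_closed: "A \<in> carrier SL2 \<Longrightarrow> adj2 A \<in> carrier SL2"
  by (simp add: carrier_SL2 adj2_def det_2 algebra_simps)

lemma group_SL2: "group SL2"
proof (rule groupI)
  show "\<exists>B \<in> carrier SL2. B \<otimes>\<^bsub>SL2\<^esub> A = \<one>\<^bsub>SL2\<^esub>" if "A \<in> carrier SL2" for A :: "'f::field ^ 2 ^ 2"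
    using adj2_mult[OF that] adj2_closed[OF that] by auto
qed (simp_all add: mult_closed_SL2 mat_1_SL2 matrix_mul_assoc)

lemma inv_SL2: "A \<in> carrier SL2 \<Longrightarrow> inv\<^bsub>SL2\<^esub> A = adj2 A"
  by (rule group.inv_equality[OF group_SL2]) (simp_all add: adj2_mult adj2_closed)

lemma mult_adj2: "A \<in> carrier SL2 \<Longrightarrow> A ** adj2 A = mat 1"
  using group.r_inv[OF group_SL2, of A] by (simp add: inv_SL2)

lemma SL2_diagonals_iff:
  "A \<in> SL2_diagonals \<longleftrightarrow> A $ 1 $ 2 = 0 \<and> A $ 2 $ 1 = 0 \<and> A $ 1 $ 1 * A $ 2 $ 2 = 1"
  by (auto simp: SL2_diagonals_def carrier_SL2 det_2 forall_2)

lemma SL2_scalars_iff: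
  "A \<in> SL2_scalars \<longleftrightarrow> A \<in> SL2_diagonals \<and> A $ 1 $ 1 = A $ 2 $ 2"
proof
  assume "A \<in> SL2_diagonals \<and> A $ 1 $ 1 = A $ 2 $ 2"
  moreover from this have "A = mat (A $ 1 $ 1)"
    by (simp add: SL2_diagonals_iff matrix_eq_iff_2 mat_nth_2)
  ultimately show "A \<in> SL2_scalars"
    by (auto simp: SL2_scalars_def SL2_diagonals_def)
qed (auto simp: SL2_scalars_def SL2_diagonals_def mat_nth_2)

lemma SL2_diagonals_subset: "SL2_diagonals \<subseteq> carrier SL2"
  by (auto simp: SL2_diagonals_def)

lemma subgroup_SL2_diagonals: "subgroup SL2_diagonals SL2"
proof (rule group.subgroupI[OF group_SL2 SL2_diagonals_subset])
  show "(SL2_diagonals :: ('f::field ^ 2 ^ 2) set) \<noteq> {}"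
    using SL2_diagonals_iff[of "mat 1 :: 'f ^ 2 ^ 2"] by (auto simp: mat_nth_2)
  fix A :: "'f::field ^ 2 ^ 2" assume A: "A \<in> SL2_diagonals"
  then have "A \<in> carrier SL2" using SL2_diagonals_subset by blast
  then show "inv\<^bsub>SL2\<^esub> A \<in> SL2_diagonals"
    using A by (simp add: inv_SL2 SL2_diagonals_iff adj2_def mult.commute)
  fix B :: "'f ^ 2 ^ 2" assume B: "B \<in> SL2_diagonals"
  have "A $ 1 $ 1 * B $ 1 $ 1 * (A $ 2 $ 2 * B $ 2 $ 2) =
      (A $ 1 $ 1 * A $ 2 $ 2) * (B $ 1 $ 1 * B $ 2 $ 2)" by (simp only: mult_ac)
  also have "\<dots> = 1" using A B by (simp only: SL2_diagonals_iff mult_1)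
  finally show "A \<otimes>\<^bsub>SL2\<^esub> B \<in> SL2_diagonals"
    using A B by (simp add: SL2_diagonals_iff matrix_mult_nth_2)
qed

lemma normal_SL2_scalars: "SL2_scalars \<lhd> SL2"
  unfolding group.normal_inv_iff[OF group_SL2]
proof (intro conjI ballI)
  show "subgroup SL2_scalars SL2"
  proof (rule group.subgroupI[OF group_SL2])
    show "SL2_scalars \<subseteq> carrier SL2" by (auto simp: SL2_scalars_def)
    show "(SL2_scalars :: ('f::field ^ 2 ^ 2) set) \<noteq> {}"
      using mat_1_SL2 by (auto simp: SL2_scalars_def)
    fix A :: "'f::field ^ 2 ^ 2" assume A: "A \<in> SL2_scalars"
    then have D: "A \<in> SL2_diagonals" by (simp add: SL2_scalars_iff)
    then have "A \<in> carrier SL2" using SL2_diagonals_subset by blast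
    then show "inv\<^bsub>SL2\<^esub> A \<in> SL2_scalars"
      using subgroup.m_inv_closed[OF subgroup_SL2_diagonals D] A
      by (simp add: inv_SL2 SL2_scalars_iff adj2_def)
    fix B :: "'f ^ 2 ^ 2" assume B: "B \<in> SL2_scalars"
    have "A ** B \<in> SL2_diagonals"
      using subgroup.m_closed[OF subgroup_SL2_diagonals D, of B] B by (simp add: SL2_scalars_iff)
    moreover have "(A ** B) $ 1 $ 1 = (A ** B) $ 2 $ 2"
      using A B by (simp add: SL2_scalars_iff SL2_diagonals_iff matrix_mult_nth_2)
    ultimately show "A \<otimes>\<^bsub>SL2\<^esub> B \<in> SL2_scalars" by (simp add: SL2_scalars_iff)
  qed
next
  fix A Z :: "'f::field ^ 2 ^ 2" assume A: "A \<in> carrier SL2" and Z: "Z \<in> SL2_scalars"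
  \<comment> \<open>Scalar matrices are central, so conjugation fixes them.\<close>
  have "A ** Z = Z ** A"
    using Z by (simp add: SL2_scalars_iff SL2_diagonals_iff matrix_eq_iff_2 matrix_mult_nth_2)
  then have "A ** Z ** adj2 A = Z"
    using mult_adj2[OF A] by (metis matrix_mul_assoc matrix_mul_rid)
  then show "A \<otimes>\<^bsub>SL2\<^esub> Z \<otimes>\<^bsub>SL2\<^esub> inv\<^bsub>SL2\<^esub> A \<in> SL2_scalars"
    using Z A by (simp add: inv_SL2)
qed

section \<open>The group PSL(2) and the cosets of the Cartan subgroup\<close>

lemma group_PSL2: "group PSL2"
  unfolding PSL2_def by (rule normal.factorgroup_is_group[OF normal_SL2_scalars])

abbreviation psl :: "'f::field ^ 2 ^ 2 \<Rightarrow> ('f ^ 2 ^ 2) set" where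
  "psl A \<equiv> SL2_scalars #>\<^bsub>SL2\<^esub> A"

lemma carrier_PSL2: "carrier PSL2 = psl ` carrier SL2"
  by (simp add: PSL2_def carrier_FactGroup)

lemma psl_mult:
  "A \<in> carrier SL2 \<Longrightarrow> B \<in> carrier SL2 \<Longrightarrow> psl A \<otimes>\<^bsub>PSL2\<^esub> psl B = psl (A ** B)"
  using normal.rcos_sum[OF normal_SL2_scalars, of A B] by (simp add: PSL2_def)

lemma subgroup_cartan: "subgroup cartan_subgroup PSL2"
proof -
  have "psl \<in> hom SL2 PSL2"
    by (rule homI) (simp_all add: carrier_PSL2 psl_mult)
  then have "group_hom SL2 PSL2 psl"
    by (intro group_hom.intro group_SL2 group_PSL2 group_hom_axioms.intro)
  then show ?thesis
    unfolding cartan_subgroup_def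
    by (rule group_hom.subgroup_img_is_subgroup[OF _ subgroup_SL2_diagonals])
qed

text \<open>A point of the scheme is named by a matrix in SL(2); the two rows, each up to a scalar,
  are its ordered pair of points of the projective line.\<close>

definition cartan_point :: "'f::field ^ 2 ^ 2 \<Rightarrow> ('f ^ 2 ^ 2) set set" where
  "cartan_point A = cartan_subgroup #>\<^bsub>PSL2\<^esub> psl A"

lemma cartan_point_mult:
  assumes "A \<in> carrier SL2" and "g \<in> carrier SL2"
  shows "cartan_point A #>\<^bsub>PSL2\<^esub> psl g = cartan_point (A ** g)"
  unfolding cartan_point_def
  using group.coset_mult_assoc[OF group_PSL2 subgroup.subset[OF subgroup_cartan], of "psl A" "psl g"]
    assms by (simp add: carrier_PSL2 psl_mult)

text \<open>Computations take place with matrices instead of nested cosets: the diagonal subgroup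
  contains the scalars, so it is the full preimage of the Cartan subgroup.\<close>

lemma cartan_point_eq_iff:
  assumes A: "A \<in> carrier SL2" and B: "B \<in> carrier SL2"
  shows "cartan_point A = cartan_point B \<longleftrightarrow> (\<exists>D \<in> SL2_diagonals. B = D ** A)"
proof
  assume eq: "cartan_point A = cartan_point B"
  have "psl B \<in> cartan_point B"
    unfolding cartan_point_def
    by (rule group.rcos_self[OF group_PSL2 _ subgroup_cartan]) (use B carrier_PSL2 in blast)
  then have "psl B \<in> cartan_point A" using eq by simp
  then obtain D where D: "D \<in> SL2_diagonals" and BD: "psl B = psl D \<otimes>\<^bsub>PSL2\<^esub> psl A"
    unfolding cartan_point_def r_coset_def[of PSL2] cartan_subgroup_def by blast
  have "D \<in> carrier SL2" using D SL2_diagonals_subset by blast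
  then have "psl B = psl (D ** A)" using BD psl_mult A by metis
  then have "B \<in> psl (D ** A)"
    using group.rcos_self[OF group_SL2 B normal_imp_subgroup[OF normal_SL2_scalars]] by simp
  then obtain Z where Z: "Z \<in> SL2_scalars" "B = Z ** (D ** A)"
    unfolding r_coset_def by auto
  \<comment> \<open>The scalar left open by lifting from PSL(2) is absorbed into the diagonal
    factor.\<close>
  have "Z ** D \<in> SL2_diagonals"
    using subgroup.m_closed[OF subgroup_SL2_diagonals, of Z D] Z(1) D by (simp add: SL2_scalars_iff)
  then show "\<exists>D \<in> SL2_diagonals. B = D ** A" using Z(2) by (metis matrix_mul_assoc)
next
  assume "\<exists>D \<in> SL2_diagonals. B = D ** A"
  then obtain D where D: "D \<in> SL2_diagonals" "B = D ** A" by blast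
  then have "D \<in> carrier SL2" using SL2_diagonals_subset by blast
  then have "psl B = psl D \<otimes>\<^bsub>PSL2\<^esub> psl A" using D(2) A by (simp add: psl_mult)
  then have "psl B \<in> cartan_subgroup #>\<^bsub>PSL2\<^esub> psl A"
    using D(1) unfolding r_coset_def[of PSL2] cartan_subgroup_def by blast
  then show "cartan_point A = cartan_point B"
    unfolding cartan_point_def
    by (rule group.repr_independence[OF group_PSL2 _ _ subgroup_cartan]) (use A carrier_PSL2 in blast)
qed

lemma cartan_point_mult_cong:
  assumes "A \<in> carrier SL2" "B \<in> carrier SL2" "g \<in> carrier SL2" and "cartan_point A = cartan_point B"
  shows "cartan_point (A ** g) = cartan_point (B ** g)"
  using assms by (simp flip: cartan_point_mult)

section \<open>Points and orbits of the Cartan scheme\<close>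

lemma points_cartan_scheme: "points cartan_scheme = cartan_point ` carrier SL2"
  by (auto simp: cartan_scheme_def coset_scheme_def RCOSETS_def carrier_PSL2 cartan_point_def)

definition cartan_orbit :: "'f::field ^ 2 ^ 2 \<Rightarrow> 'f ^ 2 ^ 2 \<Rightarrow> ('f ^ 2 ^ 2) set set rel" where
  "cartan_orbit A B = {(cartan_point (A ** g), cartan_point (B ** g)) | g. g \<in> carrier SL2}"

lemma basis_cartan_scheme:
  "basis (cartan_scheme :: ('f::field ^ 2 ^ 2) set set config) =
    {cartan_orbit A B | A B. A \<in> carrier SL2 \<and> B \<in> carrier SL2}"
proof -
  have "orbit PSL2 (\<lambda>g (A, B). (A #>\<^bsub>PSL2\<^esub> g, B #>\<^bsub>PSL2\<^esub> g)) (cartan_point A, cartan_point B) =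
      cartan_orbit A B" if "A \<in> carrier SL2" "B \<in> carrier SL2" for A B :: "'f ^ 2 ^ 2"
  proof -
    have "orbit PSL2 (\<lambda>g (A, B). (A #>\<^bsub>PSL2\<^esub> g, B #>\<^bsub>PSL2\<^esub> g)) (cartan_point A, cartan_point B) =
        (\<lambda>g. (cartan_point A #>\<^bsub>PSL2\<^esub> g, cartan_point B #>\<^bsub>PSL2\<^esub> g)) ` psl ` carrier SL2"
      unfolding orbit_def carrier_PSL2 by auto
    also have "\<dots> = (\<lambda>g. (cartan_point (A ** g), cartan_point (B ** g))) ` carrier SL2"
      unfolding image_image using that by (intro image_cong) (simp_all add: cartan_point_mult)
    finally show ?thesis unfolding cartan_orbit_def by auto
  qed
  note orb = this
  have basis: "basis cartan_scheme = {orbit PSL2 (\<lambda>g (A, B). (A #>\<^bsub>PSL2\<^esub> g, B #>\<^bsub>PSL2\<^esub> g)) x | x.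
      x \<in> points cartan_scheme \<times> points cartan_scheme}"
    by (simp add: cartan_scheme_def coset_scheme_def orbits_def)
  show ?thesis
  proof (intro equalityI subsetI)
    fix s :: "('f ^ 2 ^ 2) set set rel" assume "s \<in> basis cartan_scheme"
    then show "s \<in> {cartan_orbit A B | A B. A \<in> carrier SL2 \<and> B \<in> carrier SL2}"
      unfolding basis points_cartan_scheme using orb by blast
  next
    fix s :: "('f ^ 2 ^ 2) set set rel"
    assume "s \<in> {cartan_orbit A B | A B. A \<in> carrier SL2 \<and> B \<in> carrier SL2}"
    then show "s \<in> basis cartan_scheme"
      unfolding basis points_cartan_scheme using orb by blast
  qed
qed

lemma cartan_orbit_self:
  "(cartan_point A, cartan_point B) \<in> cartan_orbit A B"
  unfolding cartan_orbit_def by (intro CollectI exI[of _ "mat 1"]) (simp add: mat_1_SL2)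

lemma cartan_orbit_eq:
  assumes "A \<in> carrier SL2" "B \<in> carrier SL2" "C \<in> carrier SL2" "D \<in> carrier SL2"
    and "(cartan_point C, cartan_point D) \<in> cartan_orbit A B"
  shows "cartan_orbit A B = cartan_orbit C D"
proof -
  obtain g where g: "g \<in> carrier SL2" "cartan_point C = cartan_point (A ** g)"
      "cartan_point D = cartan_point (B ** g)"
    using assms(5) unfolding cartan_orbit_def by blast
  have mult: "cartan_point (C ** h) = cartan_point (A ** (g ** h))"
      "cartan_point (D ** h) = cartan_point (B ** (g ** h))" if "h \<in> carrier SL2" for h
    using cartan_point_mult_cong[OF assms(3) mult_closed_SL2[OF assms(1) g(1)] that g(2)]
      cartan_point_mult_cong[OF assms(4) mult_closed_SL2[OF assms(2) g(1)] that g(3)]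
    by (simp_all add: matrix_mul_assoc)
  show ?thesis
  proof
    show "cartan_orbit C D \<subseteq> cartan_orbit A B"
      unfolding cartan_orbit_def using mult mult_closed_SL2[OF g(1)] by blast
    show "cartan_orbit A B \<subseteq> cartan_orbit C D"
    proof
      fix p assume "p \<in> cartan_orbit A B"
      then obtain h where h: "h \<in> carrier SL2" "p = (cartan_point (A ** h), cartan_point (B ** h))"
        unfolding cartan_orbit_def by blast
      let ?h = "adj2 g ** h"
      have h': "?h \<in> carrier SL2" using mult_closed_SL2 adj2_closed g(1) h(1) by blast
      have "g ** ?h = h" using mult_adj2[OF g(1)] by (simp add: matrix_mul_assoc)
      then have "p = (cartan_point (C ** ?h), cartan_point (D ** ?h))" using mult[OF h'] h(2) by simp
      then show "p \<in> cartan_orbit C D" unfolding cartan_orbit_def using h' by blast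
    qed
  qed
qed

lemma cartan_orbit_subset:
  assumes "A \<in> carrier SL2" and "B \<in> carrier SL2"
  shows "cartan_orbit A B \<subseteq> points cartan_scheme \<times> points cartan_scheme"
  unfolding cartan_orbit_def points_cartan_scheme using assms mult_closed_SL2 by blast

lemma partition_cartan_scheme:
  "partition_on (points cartan_scheme \<times> points cartan_scheme)
    (basis (cartan_scheme :: ('f::field ^ 2 ^ 2) set set config))"
    (is "partition_on _ (basis ?X)")
  unfolding partition_on_def
proof (intro conjI)
  show "\<Union>(basis ?X) = points ?X \<times> points ?X"
  proof
    show "\<Union>(basis ?X) \<subseteq> points ?X \<times> points ?X"
      unfolding basis_cartan_scheme using cartan_orbit_subset by blast
    show "points ?X \<times> points ?X \<subseteq> \<Union>(basis ?X)"
      unfolding basis_cartan_scheme points_cartan_scheme using cartan_orbit_self by blast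
  qed
  show "{} \<notin> basis ?X"
    unfolding basis_cartan_scheme using cartan_orbit_self by blast
  show "disjoint (basis ?X)"
    unfolding disjoint_def
  proof (intro ballI impI)
    fix s t :: "('f ^ 2 ^ 2) set set rel"
    assume s: "s \<in> basis ?X" and t: "t \<in> basis ?X" and ne: "s \<noteq> t"
    obtain A B where A: "A \<in> carrier SL2" "B \<in> carrier SL2" "s = cartan_orbit A B"
      using s unfolding basis_cartan_scheme by blast
    obtain A' B' where A': "A' \<in> carrier SL2" "B' \<in> carrier SL2" "t = cartan_orbit A' B'"
      using t unfolding basis_cartan_scheme by blast
    have False if xy: "(x, y) \<in> s" "(x, y) \<in> t" for x y
    proof -
      obtain C D where "C \<in> carrier SL2" "D \<in> carrier SL2" "x = cartan_point C" "y = cartan_point D"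
        using cartan_orbit_subset[OF A(1,2)] xy(1) A(3) unfolding points_cartan_scheme by blast
      then show False using cartan_orbit_eq A A' xy ne by metis
    qed
    then show "s \<inter> t = {}" by auto
  qed
qed

lemma cell_cartan_scheme:
  assumes "A \<in> carrier SL2" and "B \<in> carrier SL2"
  shows "cell (basis cartan_scheme) (cartan_point A, cartan_point B) = cartan_orbit A B"
  by (rule cell_eq[OF partition_cartan_scheme _ cartan_orbit_self])
    (use assms basis_cartan_scheme in blast)

text \<open>The action is transitive, so the diagonal is one orbit, that of the base point.\<close>

lemma Id_on_cartan_scheme: "Id_on (points cartan_scheme) \<in> basis cartan_scheme"
proof -
  have "Id_on (points cartan_scheme) = cartan_orbit (mat 1) (mat 1)"
    unfolding points_cartan_scheme cartan_orbit_def by (auto simp: Id_on_def)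
  then show ?thesis unfolding basis_cartan_scheme using mat_1_SL2 by blast
qed

section \<open>Determination of points in the Cartan scheme\<close>

text \<open>The product of the diagonal entries of \<open>A B\<^sup>-\<^sup>1\<close>, which for \<open>det A = det B = 1\<close> is the cross
  ratio of the rows of \<open>A\<close> and \<open>B\<close> as points of the projective line.\<close>

definition cross :: "'f::field ^ 2 ^ 2 \<Rightarrow> 'f ^ 2 ^ 2 \<Rightarrow> 'f" where
  "cross A B = (A $ 1 $ 1 * B $ 2 $ 2 - A $ 1 $ 2 * B $ 2 $ 1) *
               (A $ 2 $ 2 * B $ 1 $ 1 - A $ 2 $ 1 * B $ 1 $ 2)"

lemma cross_diagonal:
  assumes D: "D \<in> SL2_diagonals"
  shows "cross (D ** A) B = cross A B" and "cross A (D ** B) = cross A B"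
proof -
  have d: "D $ 1 $ 2 = 0" "D $ 2 $ 1 = 0" "D $ 1 $ 1 * D $ 2 $ 2 = 1"
    using D by (auto simp: SL2_diagonals_iff)
  have "cross (D ** A) B = (D $ 1 $ 1 * D $ 2 $ 2) * cross A B"
    by (simp add: cross_def matrix_mult_nth_2 d(1,2) algebra_simps)
  then show "cross (D ** A) B = cross A B" using d(3) by simp
  have "cross A (D ** B) = (D $ 1 $ 1 * D $ 2 $ 2) * cross A B"
    by (simp add: cross_def matrix_mult_nth_2 d(1,2) algebra_simps)
  then show "cross A (D ** B) = cross A B" using d(3) by simp
qed

text \<open>Makes \<open>cross\<close> a function of the two points, independent of the chosen
  matrices.\<close>

lemma cross_cong:
  assumes "A \<in> carrier SL2" "A' \<in> carrier SL2" "B \<in> carrier SL2" "B' \<in> carrier SL2"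
    and "cartan_point A = cartan_point A'" and "cartan_point B = cartan_point B'"
  shows "cross A B = cross A' B'"
  using assms cartan_point_eq_iff cross_diagonal by metis

text \<open>Both factors of \<open>cross\<close> are determinants of one row of \<open>A\<close> and
  one row of \<open>B\<close>, so each is scaled by \<open>det g\<close>.\<close>

lemma cross_mult:
  assumes "g \<in> carrier SL2"
  shows "cross (A ** g) (B ** g) = cross A B"
proof -
  have "cross (A ** g) (B ** g) = (det g)\<^sup>2 * cross A B"
    unfolding det_2 cross_def matrix_mult_nth_2 by (simp add: power2_eq_square algebra_simps)
  then show ?thesis using assms by (simp add: carrier_SL2)
qed

text \<open>The stabilizer of the base point is the diagonal subgroup, so the points in the same
  relation to it form the orbit of \<open>C\<close> under diagonal matrices.\<close>

lemma cell_base_point: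
  assumes C: "C \<in> carrier SL2"
    and "(cartan_point (mat 1), x) \<in> cell (basis cartan_scheme) (cartan_point (mat 1), cartan_point C)"
  obtains D where "D \<in> SL2_diagonals" "x = cartan_point (C ** D)"
proof -
  obtain g where g: "g \<in> carrier SL2" "cartan_point (mat 1) = cartan_point g" "x = cartan_point (C ** g)"
    using assms(2) unfolding cell_cartan_scheme[OF mat_1_SL2 C] cartan_orbit_def by auto
  then have "g \<in> SL2_diagonals" using cartan_point_eq_iff[OF mat_1_SL2 g(1)] by auto
  then show ?thesis using that g(3) by blast
qed

text \<open>As a function of the square of the diagonal entry \<open>y\<close> of \<open>D\<close>, \<open>cross (C ** D) B\<close> has a pole
  at exactly one of \<open>0\<close> and \<open>\<infinity>\<close>; being of degree one it takes the value at \<open>y\<^sup>2 = 1\<close> only there.\<close>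

lemma linked_cartan_step:
  fixes B C :: "'f::field ^ 2 ^ 2"
  assumes B: "B \<in> carrier SL2" and C: "C \<in> carrier SL2"
    and xor: "(C $ 1 $ 1 * C $ 2 $ 1 * (B $ 1 $ 2 * B $ 2 $ 2) = 0) \<noteq>
              (C $ 1 $ 2 * C $ 2 $ 2 * (B $ 1 $ 1 * B $ 2 $ 1) = 0)"
  shows "linked cartan_scheme (cartan_point (mat 1)) (cartan_point B) (cartan_point C)"
proof (rule linked.step)
  show "cartan_point B \<in> points cartan_scheme" "cartan_point C \<in> points cartan_scheme"
    using B C by (auto simp: points_cartan_scheme)
  fix x assume x: "(cartan_point (mat 1), x)
      \<in> cell (basis cartan_scheme) (cartan_point (mat 1), cartan_point C)"
    and "(cartan_point B, x) \<in> cell (basis cartan_scheme) (cartan_point B, cartan_point C)"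
  then obtain g where g: "g \<in> carrier SL2" "cartan_point B = cartan_point (B ** g)"
      "x = cartan_point (C ** g)"
    unfolding cell_cartan_scheme[OF B C] cartan_orbit_def by blast
  obtain D where D: "D \<in> SL2_diagonals" "x = cartan_point (C ** D)"
    by (rule cell_base_point[OF C x])
  have D': "D \<in> carrier SL2" using D(1) SL2_diagonals_subset by blast
  \<comment> \<open>Both \<open>D\<close> and \<open>g\<close> carry the point of \<open>C\<close>
    to \<open>x\<close>, and \<open>g\<close> fixes the point of \<open>B\<close>, so the cross
    ratio with \<open>B\<close> is unchanged.\<close>
  have "cross (C ** D) B = cross (C ** g) (B ** g)"
    by (rule cross_cong) (use B C D' D(2) g mult_closed_SL2 in auto)
  then have eq: "cross (C ** D) B = cross C B" using cross_mult[OF g(1)] by simp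
  define y w where "y = D $ 1 $ 1" and "w = D $ 2 $ 2"
  have d: "D $ 1 $ 2 = 0" "D $ 2 $ 1 = 0" "y * w = 1"
    using D(1) by (auto simp: SL2_diagonals_iff y_def w_def)
  \<comment> \<open>Up to sign, \<open>U\<close> and \<open>V\<close> are the coefficients of the
    squares of \<open>y\<close> and \<open>w\<close>, and \<open>m\<close> is the constant term;
    \<open>xor\<close> says that exactly one of \<open>U\<close> and \<open>V\<close>
    vanishes.\<close>
  define U V m where "U = C $ 1 $ 1 * C $ 2 $ 1 * (B $ 1 $ 2 * B $ 2 $ 2)"
    and "V = C $ 1 $ 2 * C $ 2 $ 2 * (B $ 1 $ 1 * B $ 2 $ 1)"
    and "m = C $ 1 $ 1 * C $ 2 $ 2 * (B $ 1 $ 1 * B $ 2 $ 2)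
      + C $ 1 $ 2 * C $ 2 $ 1 * (B $ 1 $ 2 * B $ 2 $ 1)"
  note UVm = this
  have "cross (C ** D) B = (y * w) * m - y * y * U - w * w * V"
    by (simp add: UVm cross_def matrix_mult_nth_2 d(1,2) algebra_simps flip: y_def w_def)
  then have "cross (C ** D) B = m - y * y * U - w * w * V" using d(3) by simp
  moreover have "cross C B = m - U - V"
    by (simp add: UVm cross_def algebra_simps)
  ultimately have "(y * y - 1) * U + (w * w - 1) * V = 0"
    using eq by (simp add: algebra_simps)
  moreover have "(U = 0) \<noteq> (V = 0)" using xor by (simp add: UVm)
  ultimately have "y * y - 1 = 0 \<or> w * w - 1 = 0" by (cases "U = 0") auto
  \<comment> \<open>As \<open>w\<close> is the inverse of \<open>y\<close>, either alternative makes
    \<open>D\<close> scalar, so \<open>D\<close> commutes with \<open>C\<close> and leaves its point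
    unchanged.\<close>
  then have yw: "y = w"
  proof
    assume "y * y - 1 = 0"
    then have "y * y = y * w" using d(3) by simp
    moreover have "y \<noteq> 0" using d(3) by auto
    ultimately show ?thesis by simp
  next
    assume "w * w - 1 = 0"
    then have "w * w = y * w" using d(3) by simp
    moreover have "w \<noteq> 0" using d(3) by auto
    ultimately show ?thesis by simp
  qed
  have "C ** D = D ** C"
    using d yw by (simp add: matrix_eq_iff_2 matrix_mult_nth_2 mult.commute flip: y_def w_def)
  then show "x = cartan_point C"
    using D cartan_point_eq_iff[OF C mult_closed_SL2[OF C D']] by metis
qed

text \<open>Here \<open>C\<close> is monomial, so its point is the base pair in one of its two
  orders. The stabilizer of the base point fixes it, and the relation to the base point alone
  identifies it.\<close>

lemma linked_cartan_monomial:
  fixes B C :: "'f::field ^ 2 ^ 2"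
  assumes B: "B \<in> carrier SL2" and C: "C \<in> carrier SL2"
    and zero: "C $ 1 $ 1 * C $ 2 $ 1 = 0" "C $ 1 $ 2 * C $ 2 $ 2 = 0"
  shows "linked cartan_scheme (cartan_point (mat 1)) (cartan_point B) (cartan_point C)"
proof (rule linked.step)
  show "cartan_point B \<in> points cartan_scheme" "cartan_point C \<in> points cartan_scheme"
    using B C by (auto simp: points_cartan_scheme)
  fix x assume x: "(cartan_point (mat 1), x)
      \<in> cell (basis cartan_scheme) (cartan_point (mat 1), cartan_point C)"
  obtain D where D: "D \<in> SL2_diagonals" "x = cartan_point (C ** D)"
    by (rule cell_base_point[OF C x])
  have D': "D \<in> carrier SL2" using D(1) SL2_diagonals_subset by blast
  have d: "D $ 1 $ 2 = 0" "D $ 2 $ 1 = 0" "D $ 1 $ 1 * D $ 2 $ 2 = 1"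
    using D(1) by (auto simp: SL2_diagonals_iff)
  have "det C = 1" using C by (simp add: carrier_SL2)
  then have "(C $ 1 $ 2 = 0 \<and> C $ 2 $ 1 = 0) \<or> (C $ 1 $ 1 = 0 \<and> C $ 2 $ 2 = 0)"
    using zero by (auto simp: det_2)
  then have "\<exists>E \<in> SL2_diagonals. C ** D = E ** C"
  proof
    assume "C $ 1 $ 2 = 0 \<and> C $ 2 $ 1 = 0"
    then have "C ** D = D ** C"
      using d by (simp add: matrix_eq_iff_2 matrix_mult_nth_2 mult.commute)
    then show ?thesis using D(1) by blast
  next
    assume "C $ 1 $ 1 = 0 \<and> C $ 2 $ 2 = 0"
    then have "C ** D = adj2 D ** C"
      using d by (simp add: matrix_eq_iff_2 matrix_mult_nth_2 adj2_def mult.commute)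
    moreover have "adj2 D \<in> SL2_diagonals"
      using d by (simp add: SL2_diagonals_iff adj2_def mult.commute)
    ultimately show ?thesis by blast
  qed
  then show "x = cartan_point C"
    using D cartan_point_eq_iff[OF C mult_closed_SL2[OF C D']] by metis
qed

text \<open>For \<open>?B\<close> only the coefficient of the first column of \<open>C\<close> can
  survive, for \<open>?E\<close> only that of the second. So \<open>?B\<close> reaches the matrices
  without a zero in the first column, among them \<open>?E\<close>, and \<open>?E\<close> reaches
  those without a zero in the second. If both columns contain a zero, the matrix is
  monomial.\<close>

lemma linked_cartan:
  fixes C :: "'f::field ^ 2 ^ 2"
  assumes C: "C \<in> carrier SL2"
  shows "linked cartan_scheme (cartan_point (mat 1)) (cartan_point (mat2 1 1 0 1)) (cartan_point C)"
proof -
  let ?L = "linked cartan_scheme (cartan_point (mat 1 :: 'f ^ 2 ^ 2))"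
  let ?B = "mat2 1 1 0 1 :: 'f ^ 2 ^ 2" and ?E = "mat2 1 0 1 1 :: 'f ^ 2 ^ 2"
  have B: "?B \<in> carrier SL2" and E: "?E \<in> carrier SL2"
    by (simp_all add: carrier_SL2 det_2)
  have generic: "?L (cartan_point ?B) (cartan_point A)"
    if "A \<in> carrier SL2" "A $ 1 $ 1 * A $ 2 $ 1 \<noteq> 0" for A
    by (rule linked_cartan_step[OF B that(1)]) (use that(2) in simp)
  consider "C $ 1 $ 1 * C $ 2 $ 1 \<noteq> 0" | "C $ 1 $ 1 * C $ 2 $ 1 = 0" "C $ 1 $ 2 * C $ 2 $ 2 \<noteq> 0"
    | "C $ 1 $ 1 * C $ 2 $ 1 = 0" "C $ 1 $ 2 * C $ 2 $ 2 = 0" by blast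
  then show ?thesis
  proof cases
    case 1
    then show ?thesis by (rule generic[OF C])
  next
    case 2
    have "?L (cartan_point ?E) (cartan_point C)"
      by (rule linked_cartan_step[OF E C]) (use 2 in simp)
    moreover have "?L (cartan_point ?B) (cartan_point ?E)"
      by (rule generic[OF E]) simp
    ultimately show ?thesis by (rule linked.trans[rotated])
  next
    case 3
    then show ?thesis by (rule linked_cartan_monomial[OF B C])
  qed
qed

section \<open>One point is not a base\<close>

lemma cartan_point_conjugate:
  fixes D :: "'f::field ^ 2 ^ 2"
  assumes A: "A \<in> carrier SL2" and D: "D \<in> SL2_diagonals"
  shows "cartan_point (A ** (adj2 A ** D ** A)) = cartan_point A"
proof -
  have D': "D \<in> carrier SL2" using D SL2_diagonals_subset by blast
  have "A ** (adj2 A ** D ** A) = D ** A"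
    using mult_adj2[OF A] by (simp add: matrix_mul_assoc)
  then show ?thesis
    using cartan_point_eq_iff[OF A mult_closed_SL2[OF D' A]] D by metis
qed

text \<open>The diagonal matrix with entries \<open>y\<close> and \<open>1 / y\<close> is not
  scalar. Its conjugate by \<open>A\<close> fixes \<alpha>, preserves all orbits and moves another
  point, so \<open>not_is_base_invariant\<close> applies. The inclusion in the hypothesis also
  covers the empty set.\<close>

lemma not_is_base_cartan_singleton:
  fixes y :: "'f::{field,finite}"
  assumes y: "y \<noteq> 0" "y * y \<noteq> 1" and \<alpha>: "\<alpha> \<in> points cartan_scheme"
    and sub: "S \<subseteq> {\<alpha>}"
  shows "\<not> is_base cartan_scheme (S :: ('f ^ 2 ^ 2) set set set)"
proof -
  obtain A where A: "A \<in> carrier SL2" "\<alpha> = cartan_point A"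
    using \<alpha> unfolding points_cartan_scheme by blast
  let ?D = "mat2 y 0 0 (1 / y)"
  have D: "?D \<in> SL2_diagonals" using y by (simp add: SL2_diagonals_iff)
  then have D': "?D \<in> carrier SL2" using SL2_diagonals_subset by blast
  define g where "g = adj2 A ** ?D ** A"
  have g: "g \<in> carrier SL2"
    unfolding g_def using mult_closed_SL2 adj2_closed A(1) D' by blast
  let ?h = "\<lambda>x. x #>\<^bsub>PSL2\<^esub> psl g"
  have h: "?h (cartan_point B) = cartan_point (B ** g)" if "B \<in> carrier SL2" for B
    by (rule cartan_point_mult[OF that g])
  have h_adj: "?h (cartan_point (B ** adj2 g)) = cartan_point B" if "B \<in> carrier SL2" for B
    using h[OF mult_closed_SL2[OF that adj2_closed[OF g]]] adj2_mult[OF g]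
    by (simp add: matrix_mul_assoc[symmetric])
  have im: "?h ` points cartan_scheme = points cartan_scheme"
  proof
    show "?h ` points cartan_scheme \<subseteq> points cartan_scheme"
      unfolding points_cartan_scheme using h mult_closed_SL2[OF _ g] by auto
    show "points cartan_scheme \<subseteq> ?h ` points cartan_scheme"
    proof
      fix x :: "('f ^ 2 ^ 2) set set" assume "x \<in> points cartan_scheme"
      then obtain B where B: "B \<in> carrier SL2" "x = cartan_point B"
        unfolding points_cartan_scheme by blast
      then have "cartan_point (B ** adj2 g) \<in> points cartan_scheme"
        unfolding points_cartan_scheme using mult_closed_SL2 adj2_closed[OF g] by blast
      then show "x \<in> ?h ` points cartan_scheme" using h_adj[OF B(1)] B(2) by (metis imageI)
    qed
  qed
  have bij: "bij_betw ?h (points cartan_scheme) (points cartan_scheme)"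
    unfolding bij_betw_def using im finite_surj_inj[of "points cartan_scheme" ?h] by simp
  have inv: "(?h x, ?h z) \<in> s \<longleftrightarrow> (x, z) \<in> s"
    if s: "s \<in> basis cartan_scheme"
      and xz: "x \<in> points cartan_scheme" "z \<in> points cartan_scheme" for s x z
  proof -
    obtain B C where BC: "B \<in> carrier SL2" "C \<in> carrier SL2" "x = cartan_point B" "z = cartan_point C"
      using xz unfolding points_cartan_scheme by blast
    \<comment> \<open>Both pairs lie in one orbit, and a basis relation is determined by any of its
      pairs.\<close>
    then have 1: "(?h x, ?h z) \<in> cartan_orbit B C" "(x, z) \<in> cartan_orbit B C"
      using h g cartan_orbit_self unfolding cartan_orbit_def by blast+
    have 2: "cartan_orbit B C \<in> basis cartan_scheme" using BC(1,2) unfolding basis_cartan_scheme by blast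
    show ?thesis
      using cell_eq[OF partition_cartan_scheme s] cell_eq[OF partition_cartan_scheme 2] 1 by metis
  qed
  let ?U = "mat2 1 1 0 1 :: 'f ^ 2 ^ 2"
  have U: "?U \<in> carrier SL2" by (simp add: carrier_SL2 det_2)
  note UA = mult_closed_SL2[OF U A(1)]
  have moved: "?h (cartan_point (?U ** A)) \<noteq> cartan_point (?U ** A)"
  proof
    assume eq: "?h (cartan_point (?U ** A)) = cartan_point (?U ** A)"
    have "?U ** A ** g = ?U ** ?D ** A"
      unfolding g_def using mult_adj2[OF A(1)] by (metis matrix_mul_assoc matrix_mul_lid)
    then have "cartan_point (?U ** A) = cartan_point (?U ** ?D ** A)" using eq h[OF UA] by simp
    then obtain E where E: "E \<in> SL2_diagonals" "?U ** ?D ** A = E ** (?U ** A)"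
      using cartan_point_eq_iff[OF UA mult_closed_SL2[OF mult_closed_SL2[OF U D'] A(1)]] by blast
    then have "?U ** ?D ** A ** adj2 A = E ** ?U ** A ** adj2 A" by (simp add: matrix_mul_assoc)
    then have "?U ** ?D = E ** ?U"
      using mult_adj2[OF A(1)] by (metis matrix_mul_assoc matrix_mul_rid)
    \<comment> \<open>The first rows are \<open>y\<close>, \<open>1 / y\<close> on the left and a
      repeated entry on the right, which would make \<open>y\<close> its own inverse.\<close>
    then have row: "(?U ** ?D) $ 1 $ j = (E ** ?U) $ 1 $ j" for j by simp
    have "y = E $ 1 $ 1" "1 / y = E $ 1 $ 1"
      using row[of 1] row[of 2] E(1) by (simp_all add: matrix_mult_nth_2 SL2_diagonals_iff)
    then have "y = 1 / y" by metis
    then show False using y by (simp add: field_simps)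
  qed
  show ?thesis
  proof (rule not_is_base_invariant[OF _ _ bij inv _ _ moved])
    show "finite (points cartan_scheme :: ('f ^ 2 ^ 2) set set set)" by simp
    show "\<Union>(basis cartan_scheme) \<subseteq> points cartan_scheme \<times> (points cartan_scheme :: ('f ^ 2 ^ 2) set set set)"
      using partition_onD1[OF partition_cartan_scheme] by blast
    show "?h x = x" if "x \<in> S" for x
      using that sub A h[OF A(1)] cartan_point_conjugate[OF A(1) D] unfolding g_def by auto
    show "cartan_point (?U ** A) \<in> points cartan_scheme" unfolding points_cartan_scheme using UA by blast
  qed
qed

theorem theorem1p4:
  fixes q :: nat
    and X :: "('f::{field,finite} ^ 2 ^ 2) set set config"
  assumes "primepow q" and "q > 3"
    and "CARD('f) = q"
    and "X = cartan_scheme"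
  shows "m_separable TYPE('b) 2 X \<and> base_number X = 2"
proof
  let ?\<alpha> = "cartan_point (mat 1) :: ('f ^ 2 ^ 2) set set"
  let ?\<beta> = "cartan_point (mat2 1 1 0 1) :: ('f ^ 2 ^ 2) set set"
  have U: "(mat2 1 1 0 1 :: 'f ^ 2 ^ 2) \<in> carrier SL2" by (simp add: carrier_SL2 det_2)
  have fin: "finite (points X)" by simp
  have part: "partition_on (points X \<times> points X) (basis X)"
    unfolding assms(4) by (rule partition_cartan_scheme)
  have pts: "?\<alpha> \<in> points X" "?\<beta> \<in> points X"
    unfolding assms(4) points_cartan_scheme using mat_1_SL2 U by blast+
  have linked: "linked X ?\<alpha> ?\<beta> \<gamma>" if "\<gamma> \<in> points X" for \<gamma>
    using that linked_cartan unfolding assms(4) points_cartan_scheme by blast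
  have Id: "Id_on (points X) \<in> basis X" unfolding assms(4) by (rule Id_on_cartan_scheme)
  show "m_separable TYPE('b) 2 X" by (rule m_separable_linked[OF fin part Id pts linked])
  have ne: "?\<alpha> \<noteq> ?\<beta>"
    unfolding cartan_point_eq_iff[OF mat_1_SL2 U] by (auto simp: SL2_diagonals_iff)
  \<comment> \<open>This is where \<open>q > 3\<close> enters: a field element outside these at most
    three values has a square different from 1 and is nonzero.\<close>
  have "\<exists>y :: 'f. y \<notin> {0, 1, -1}"
  proof (rule ccontr)
    assume "\<not> ?thesis"
    then have "(UNIV :: 'f set) \<subseteq> {0, 1, -1}" by blast
    then have "CARD('f) \<le> card {0, 1, -1 :: 'f}" by (intro card_mono) auto
    also have "\<dots> \<le> 3" by (simp add: card_insert_if)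
    finally show False using assms(2,3) by simp
  qed
  then obtain y :: 'f where "y \<noteq> 0" "y \<noteq> 1" "y \<noteq> -1" by blast
  then have y: "y \<noteq> 0" "y * y \<noteq> 1" using square_eq_1_iff by auto
  show "base_number X = 2"
    unfolding base_number_def
  proof (rule Least_equality)
    show "\<exists>A. is_base X A \<and> card A = 2"
      using is_base_linked[OF fin part pts linked] ne by (intro exI[of _ "{?\<alpha>, ?\<beta>}"]) simp
  next
    fix n assume "\<exists>A. is_base X A \<and> card A = n"
    then obtain A where A: "is_base X A" "card A = n" by blast
    show "2 \<le> n"
    proof (rule ccontr)
      assume "\<not> 2 \<le> n"
      then have "card A \<le> Suc 0" using A(2) by simp
      then have single: "x = z" if "x \<in> A" "z \<in> A" for x z
        using card_le_Suc0_iff_eq[of A] that by simp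
      have AX: "A \<subseteq> points X" using A(1) by (simp add: is_base_def)
      \<comment> \<open>An empty \<open>A\<close> is placed inside the singleton of an arbitrary
        point, so that both small cardinalities are handled together.\<close>
      obtain x where "x \<in> points X" "A \<subseteq> {x}"
      proof (cases "A = {}")
        case True
        then show ?thesis using that pts(1) by blast
      next
        case False
        then show ?thesis using that AX single by blast
      qed
      then show False using not_is_base_cartan_singleton[OF y] A(1) unfolding assms(4) by blast
    qed
  qed
qed

end
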